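(* Let $\vec r=(r_1,\dots,r_d)\in\mathbb{R}^d$. Then the operator $\Delta_{\mathbb{Z}^d}^{\vec r}$ is essentially self-adjoint on the space $\ell^2_c(\mathbb{Z}^d)$ of finitely supported functions on $\mathbb{Z}^d$.
   Context: $\Delta_{\mathbb{Z}}=2\,\mathrm{id}-U-U^*$ on $\ell^2(\mathbb{Z})$, with $U$ the unit shift; under the discrete Fourier transform it is multiplication by $2-2\cos\theta$ on $L^2([-\pi,\pi])$. For $r\in\mathbb{R}$, $\Delta_{\mathbb{Z}}^r$ is defined by Borel functional calculus (multiplication by $(2-2\cos\theta)^r$). $\Delta_{\mathbb{Z}^d}^{\vec r}=\sum_{j=1}^d\mathrm{id}^{\otimes(j-1)}\otimes\Delta_{\mathbb{Z}}^{r_j}\otimes\mathrm{id}^{\otimes(d-j)}$ on $\ell^2(\mathbb{Z}^d)=\ell^2(\mathbb{Z})^{\otimes d}$, i.e. under Fourier transform multiplication by $\sum_{j=1}^d(2-2\cos\theta_j)^{r_j}$.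
   Formalization: The operator is restricted to those finitely supported functions lying in its domain; if some r_j ≤ -1/4, not all of ℓ²_c(Z^d) lies in the domain (e.g. δ_0 does not), so the claim on all of ℓ²_c would be ill-defined there. *)

theory Defs
  imports "HOL-Analysis.Analysis"
begin

section \<open>The Hilbert space of square-summable functions\<close>

definition ell2 :: "('i \<Rightarrow> complex) set" where
  "ell2 = {f. (\<lambda>x. (cmod (f x))\<^sup>2) summable_on UNIV}"

definition ell2_inner :: "('i \<Rightarrow> complex) \<Rightarrow> ('i \<Rightarrow> complex) \<Rightarrow> complex" where
  "ell2_inner f g = (\<Sum>\<^sub>\<infinity>x. f x * cnj (g x))"

definition ell2_norm :: "('i \<Rightarrow> complex) \<Rightarrow> real" where
  "ell2_norm f = sqrt (\<Sum>\<^sub>\<infinity>x. (cmod (f x))\<^sup>2)"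

definition ell2_c :: "('i \<Rightarrow> complex) set" where
  "ell2_c = {f. finite {x. f x \<noteq> 0}}"


section \<open>Unbounded operators\<close>

text \<open>
  An unbounded operator is represented by its graph, so that its domain is
  \<^const>\<open>Domain\<close> of the graph.  The predicate below says that a relation is the graph of a
  (not necessarily densely defined or closed) complex-linear operator.
\<close>

type_synonym 'i graph = "(('i \<Rightarrow> complex) \<times> ('i \<Rightarrow> complex)) set"

definition linear_operator :: "'i graph \<Rightarrow> bool" where
  "linear_operator T \<longleftrightarrow>
     T \<subseteq> ell2 \<times> ell2 \<and> single_valued T \<and> ((\<lambda>_. 0), (\<lambda>_. 0)) \<in> T \<and>
     (\<forall>(u, v)\<in>T. \<forall>(u', v')\<in>T. ((\<lambda>x. u x + u' x), (\<lambda>x. v x + v' x)) \<in> T) \<and>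
     (\<forall>c. \<forall>(u, v)\<in>T. ((\<lambda>x. c * u x), (\<lambda>x. c * v x)) \<in> T)"

definition densely_defined :: "'i graph \<Rightarrow> bool" where
  "densely_defined T \<longleftrightarrow>
     (\<forall>f\<in>ell2. \<forall>e>0. \<exists>u\<in>Domain T. ell2_norm (\<lambda>x. f x - u x) < e)"

definition op_closure :: "'i graph \<Rightarrow> 'i graph" where
  "op_closure T = {(f, g). f \<in> ell2 \<and> g \<in> ell2 \<and>
     (\<forall>e>0. \<exists>(u, v)\<in>T. ell2_norm (\<lambda>x. f x - u x) < e \<and> ell2_norm (\<lambda>x. g x - v x) < e)}"

definition op_adjoint :: "'i graph \<Rightarrow> 'i graph" where
  "op_adjoint T = {(f, g). f \<in> ell2 \<and> g \<in> ell2 \<and>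
     (\<forall>(u, v)\<in>T. ell2_inner v f = ell2_inner u g)}"

definition symmetric_operator :: "'i graph \<Rightarrow> bool" where
  "symmetric_operator T \<longleftrightarrow>
     linear_operator T \<and> densely_defined T \<and>
     (\<forall>(u, v)\<in>T. \<forall>(u', v')\<in>T. ell2_inner v u' = ell2_inner u v')"

definition self_adjoint :: "'i graph \<Rightarrow> bool" where
  "self_adjoint T \<longleftrightarrow> linear_operator T \<and> densely_defined T \<and> op_adjoint T = T"

definition essentially_self_adjoint :: "'i graph \<Rightarrow> bool" where
  "essentially_self_adjoint T \<longleftrightarrow> symmetric_operator T \<and> self_adjoint (op_closure T)"

text \<open>
  Restriction of \<open>T\<close> to those elements of \<open>D\<close> at which \<open>T\<close> is defined; \<open>D\<close> need not be
  contained in the domain.  For instance, \<open>(2 - 2 * cos \<theta>) powr a\<close> is not square-integrable near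
  0 if \<open>a \<le> -1/4\<close>, so a finitely supported \<open>f\<close> is in the domain of the corresponding
  multiplier only if its Fourier sum vanishes suitably at 0.
\<close>

definition op_restrict :: "'i graph \<Rightarrow> ('i \<Rightarrow> complex) set \<Rightarrow> 'i graph" where
  "op_restrict T D = {(u, v)\<in>T. u \<in> D}"

definition essentially_self_adjoint_on :: "'i graph \<Rightarrow> ('i \<Rightarrow> complex) set \<Rightarrow> bool" where
  "essentially_self_adjoint_on T D \<longleftrightarrow> essentially_self_adjoint (op_restrict T D)"


section \<open>Fourier multipliers on the integer lattice\<close>

definition torus :: "(real ^ 'd) measure" where
  "torus = restrict_space lborel (cbox (\<chi> j. - pi) (\<chi> j. pi))"

definition L2_torus :: "(real ^ 'd \<Rightarrow> complex) set" where
  "L2_torus = {F \<in> borel_measurable torus. integrable torus (\<lambda>\<theta>. (cmod (F \<theta>))\<^sup>2)}"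

definition fourier_sum :: "(int ^ 'd \<Rightarrow> complex) \<Rightarrow> (int ^ 'd) set \<Rightarrow> real ^ 'd \<Rightarrow> complex" where
  "fourier_sum f A \<theta> =
     complex_of_real (1 / sqrt ((2 * pi) ^ CARD('d))) *
     (\<Sum>n\<in>A. f n * cis (- (\<Sum>j\<in>UNIV. of_int (n $ j) * \<theta> $ j)))"

text \<open>
  \<open>has_fourier f F\<close>: the Fourier series of \<open>f\<close> converges to \<open>F\<close> unconditionally in the mean
  square sense.  This determines \<open>F\<close> up to null sets, so \<open>F\<close> is any representative of the
  image of \<open>f\<close> under the (unitary) discrete Fourier transform.
\<close>

definition has_fourier :: "(int ^ 'd \<Rightarrow> complex) \<Rightarrow> (real ^ 'd \<Rightarrow> complex) \<Rightarrow> bool" where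
  "has_fourier f F \<longleftrightarrow> F \<in> L2_torus \<and>
     ((\<lambda>A. \<integral>\<theta>. (cmod (F \<theta> - fourier_sum f A \<theta>))\<^sup>2 \<partial>torus) \<longlongrightarrow> 0) (finite_subsets_at_top UNIV)"

text \<open>
  The operator that becomes multiplication by \<open>m\<close> under the Fourier transform, on its maximal
  domain: \<open>f\<close> is in the domain iff \<open>m\<close> times the transform of \<open>f\<close> is square-integrable.
\<close>

definition fourier_multiplier :: "(real ^ 'd \<Rightarrow> real) \<Rightarrow> (int ^ 'd) graph" where
  "fourier_multiplier m = {(f, g). f \<in> ell2 \<and> g \<in> ell2 \<and>
     (\<exists>F G. has_fourier f F \<and> has_fourier g G \<and>
            (AE \<theta> in torus. G \<theta> = complex_of_real (m \<theta>) * F \<theta>))}"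

text \<open>
  The symbol is only relevant almost everywhere, so the convention \<open>0 powr a = 0\<close> at
  \<open>\<theta> $ j = 0\<close> (also for \<open>a \<le> 0\<close>) is harmless.
\<close>

definition frac_laplacian :: "real ^ 'd \<Rightarrow> (int ^ 'd) graph" where
  "frac_laplacian r =
     fourier_multiplier (\<lambda>\<theta>. \<Sum>j\<in>UNIV. (2 - 2 * cos (\<theta> $ j)) powr (r $ j))"


section \<open>Compatibility with the unit shifts\<close>

lemma borel_measurable_torus: "continuous_on UNIV F \<Longrightarrow> (F :: real ^ 'd \<Rightarrow> complex) \<in> borel_measurable torus"
  unfolding torus_def by (intro measurable_restrict_space1) (simp add: borel_measurable_continuous_onI)

lemma L2_torus_continuous:
  assumes "continuous_on UNIV (F :: real ^ 'd \<Rightarrow> complex)"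
  shows "F \<in> L2_torus"
proof -
  have "continuous_on (cbox (\<chi> j. - pi) (\<chi> j. pi)) (\<lambda>\<theta>. (cmod (F \<theta>))\<^sup>2)"
    by (intro continuous_intros continuous_on_subset[OF assms]) auto
  then have "set_integrable lborel (cbox (\<chi> j. - pi) (\<chi> j. pi)) (\<lambda>\<theta>. (cmod (F \<theta>))\<^sup>2)"
    unfolding set_integrable_def by (intro borel_integrable_compact) auto
  then have "integrable torus (\<lambda>\<theta>. (cmod (F \<theta>))\<^sup>2)"
    unfolding torus_def set_integrable_def by (subst integrable_restrict_space) auto
  then show ?thesis using borel_measurable_torus[OF assms] by (simp add: L2_torus_def)
qed

lemma has_fourier_finite:
  assumes "finite S" "\<And>n. n \<notin> S \<Longrightarrow> f n = 0"
  shows "has_fourier f (fourier_sum f S)"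
proof -
  have "fourier_sum f S \<in> L2_torus"
    unfolding fourier_sum_def cis_conv_exp by (intro L2_torus_continuous continuous_intros)
  moreover have "\<forall>\<^sub>F A in finite_subsets_at_top UNIV.
     (\<integral>\<theta>. (cmod (fourier_sum f S \<theta> - fourier_sum f A \<theta>))\<^sup>2 \<partial>torus) = 0"
  proof (rule eventually_finite_subsets_at_top[THEN iffD2], intro exI conjI allI impI)
    fix A assume A: "finite A \<and> S \<subseteq> A \<and> A \<subseteq> UNIV"
    then have "fourier_sum f A \<theta> = fourier_sum f S \<theta>" for \<theta>
      unfolding fourier_sum_def by (subst sum.mono_neutral_right[of A S]) (auto simp: assms)
    then show "(\<integral>\<theta>. (cmod (fourier_sum f S \<theta> - fourier_sum f A \<theta>))\<^sup>2 \<partial>torus) = 0" by simp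
  qed (use assms in auto)
  ultimately show ?thesis unfolding has_fourier_def
    by (auto intro: tendsto_eventually)
qed

lemma ell2_c_subset: "(f::'i\<Rightarrow>complex) \<in> ell2_c \<Longrightarrow> f \<in> ell2"
proof -
  assume "f \<in> ell2_c"
  then have "(\<lambda>x. (cmod (f x))\<^sup>2) summable_on {x. f x \<noteq> 0}"
    by (intro summable_on_finite) (simp add: ell2_c_def)
  moreover have "(\<lambda>x. (cmod (f x))\<^sup>2) summable_on {x. f x \<noteq> 0} \<longleftrightarrow>
      (\<lambda>x. (cmod (f x))\<^sup>2) summable_on UNIV"
    by (rule summable_on_cong_neutral) auto
  ultimately show "f \<in> ell2" by (simp add: ell2_def)
qed

lemma fourier_sum_shift:
  "fourier_sum (\<lambda>n. f (n - k)) ((\<lambda>n. n + k) ` S) \<theta> =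
   cis (- (\<Sum>j\<in>UNIV. of_int (k $ j) * \<theta> $ j)) * fourier_sum f S \<theta>"
proof -
  have "cis (- (\<Sum>j\<in>UNIV. of_int ((n + k) $ j) * \<theta> $ j)) =
      cis (- (\<Sum>j\<in>UNIV. of_int (k $ j) * \<theta> $ j)) * cis (- (\<Sum>j\<in>UNIV. of_int (n $ j) * \<theta> $ j))" for n
    by (simp add: cis_mult distrib_right sum.distrib add.commute)
  then show ?thesis
    unfolding fourier_sum_def by (simp add: sum.reindex inj_on_def sum_distrib_left mult_ac)
qed

lemma fourier_sum_mono:
  assumes "finite A" "S \<subseteq> A" "\<And>n. n \<notin> S \<Longrightarrow> f n = 0"
  shows "fourier_sum f A \<theta> = fourier_sum f S \<theta>"
  unfolding fourier_sum_def by (subst sum.mono_neutral_right[of A S]) (auto simp: assms)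

text \<open>
  For exponent 1 in every direction the operator acts on finitely supported functions as the sum
  over \<open>j\<close> of \<open>2 id - U\<^sub>j - U\<^sub>j*\<close>, where \<open>U\<^sub>j\<close> is the unit shift in direction \<open>j\<close>.
\<close>

lemma frac_laplacian_one:
  fixes f :: "int ^ 'd \<Rightarrow> complex"
  assumes "f \<in> ell2_c"
  shows "(f, \<lambda>n. \<Sum>j\<in>UNIV. 2 * f n - f (n - axis j 1) - f (n + axis j 1))
           \<in> frac_laplacian (\<chi> j. 1)"
proof -
  define S where "S = {n. f n \<noteq> 0}"
  define A where "A = S \<union> (\<Union>j. (\<lambda>n. n + axis j 1) ` S) \<union> (\<Union>j. (\<lambda>n. n + - axis j 1) ` S)"
  define g where "g = (\<lambda>n. \<Sum>j\<in>UNIV. 2 * f n - f (n - axis j 1) - f (n + axis j 1))"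
  have S: "finite S" "\<And>n. n \<notin> S \<Longrightarrow> f n = 0" using assms by (auto simp: S_def ell2_c_def)
  have A: "finite A" "S \<subseteq> A" using S by (auto simp: A_def)
  have mem: "f (n - axis j 1) = 0" "f (n + axis j 1) = 0" if "n \<notin> A" for n j
  proof -
    have "n - axis j 1 \<notin> S"
    proof
      assume "n - axis j 1 \<in> S"
      then have "n - axis j 1 + axis j 1 \<in> A" unfolding A_def by blast
      with that show False by simp
    qed
    moreover have "n + axis j 1 \<notin> S"
    proof
      assume "n + axis j 1 \<in> S"
      then have "n + axis j 1 + - axis j 1 \<in> A" unfolding A_def by blast
      with that show False by simp
    qed
    ultimately show "f (n - axis j 1) = 0" "f (n + axis j 1) = 0" using S by auto
  qed
  have gA: "g n = 0" if "n \<notin> A" for n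
    using mem[OF that] S A that by (auto simp: g_def)
  have fA: "f n = 0" if "n \<notin> A" for n using S A that by auto
  have sh: "fourier_sum (\<lambda>n. f (n - k)) A \<theta> =
      cis (- (\<Sum>j\<in>UNIV. of_int (k $ j) * \<theta> $ j)) * fourier_sum f S \<theta>"
    if "(\<lambda>n. n + k) ` S \<subseteq> A" for k \<theta>
  proof -
    have "f (n - k) = 0" if "n \<notin> (\<lambda>n. n + k) ` S" for n
    proof (rule S(2), rule notI)
      assume "n - k \<in> S"
      then have "(n - k) + k \<in> (\<lambda>n. n + k) ` S" by blast
      with that show False by simp
    qed
    then show ?thesis
      using fourier_sum_mono[OF A(1) that, of "\<lambda>n. f (n - k)"] fourier_sum_shift[of f k S] by simp
  qed
  have ax: "(\<Sum>i\<in>UNIV. of_int (axis j 1 $ i) * \<theta> $ i) = (\<theta> $ j :: real)" for j :: 'd and \<theta>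
  proof -
    have "(\<Sum>i\<in>UNIV. of_int (axis j 1 $ i) * \<theta> $ i) = (\<Sum>i\<in>UNIV. if i = j then \<theta> $ i else 0)"
      by (rule sum.cong) (auto simp: axis_def)
    then show ?thesis by simp
  qed
  have shp: "fourier_sum (\<lambda>n. f (n - axis j 1)) A \<theta> = cis (- \<theta> $ j) * fourier_sum f S \<theta>" for j \<theta>
    using sh[of "axis j 1" \<theta>] ax[of j \<theta>] by (auto simp: A_def)
  have shm: "fourier_sum (\<lambda>n. f (n + axis j 1)) A \<theta> = cis (\<theta> $ j) * fourier_sum f S \<theta>" for j \<theta>
    using sh[of "- axis j 1" \<theta>] ax[of j \<theta>] by (auto simp: A_def sum_negf)
  have lin: "fourier_sum g A \<theta> = (\<Sum>j\<in>UNIV. 2 * fourier_sum f A \<theta>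
      - fourier_sum (\<lambda>n. f (n - axis j 1)) A \<theta> - fourier_sum (\<lambda>n. f (n + axis j 1)) A \<theta>)" for \<theta>
    unfolding fourier_sum_def g_def sum_distrib_left sum_distrib_right sum_subtractf[symmetric]
    by (subst sum.swap) (simp add: algebra_simps)
  have sym: "2 - cis (- x) - cis x = complex_of_real ((2 - 2 * cos x) powr 1)" for x
    by (simp add: complex_eq_iff)
  have fSA: "fourier_sum f A \<theta> = fourier_sum f S \<theta>" for \<theta>
    using fourier_sum_mono[OF A] S(2) by blast
  have "fourier_sum g A \<theta> =
      complex_of_real (\<Sum>j\<in>UNIV. (2 - 2 * cos (\<theta> $ j)) powr ((\<chi> j. 1) $ j)) * fourier_sum f A \<theta>" for \<theta>
    unfolding lin shp shm fSA of_real_sum sum_distrib_right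
    by (rule sum.cong) (simp_all add: sym[symmetric] algebra_simps del: powr_one powr_one')
  moreover have "has_fourier f (fourier_sum f A)" "has_fourier g (fourier_sum g A)"
    using has_fourier_finite A(1) fA gA by blast+
  moreover have "f \<in> ell2" "g \<in> ell2"
  proof -
    have "{n. g n \<noteq> 0} \<subseteq> A" using gA by auto
    then have "g \<in> ell2_c" using A(1) finite_subset by (auto simp: ell2_c_def)
    then show "f \<in> ell2" "g \<in> ell2" using assms ell2_c_subset by auto
  qed
  ultimately show ?thesis
    unfolding frac_laplacian_def fourier_multiplier_def g_def[symmetric] by auto
qed

end

theory Submission
  imports Defs
begin

text \<open>
  The symbol \<open>m \<theta> = (\<Sum>j. (2 - 2 cos \<theta>\<^sub>j) powr r\<^sub>j)\<close> may be unbounded, but it becomes bounded after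
  multiplication with the trigonometric polynomial \<open>\<psi> \<theta> = (\<Prod>j. (2 - 2 cos \<theta>\<^sub>j) ^ k)\<close> for \<open>k\<close> large,
  and \<open>\<psi>\<close> vanishes only on a null set. Hence every \<open>u\<close> whose transform is \<open>\<psi> Q\<close> with a
  trigonometric polynomial \<open>Q\<close> is finitely supported and in the domain.  The transforms of
  \<open>(T \<plusminus> \<i>) u\<close> are the functions \<open>(m \<plusminus> \<i>) \<psi> Q\<close>; as \<open>(m \<plusminus> \<i>) \<psi>\<close> is bounded and nonzero almost
  everywhere, they are dense in \<open>L\<^sup>2\<close>.  So both deficiency spaces are trivial.
\<close>

section \<open>Square-integrable functions\<close>

text \<open>For negative exponents a finitely supported function need not lie in the domain, because
  \<open>m\<close> times its transform can fail to be square-integrable near the hyperplanes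
  \<theta>_j = 0. It comes from the same approximation as the deficiency argument: one density
  statement treats the functions (a m + b) \<psi> Q, with a = 1, b = \<plusminus>i for the ranges
  and a = 0, b = 1 for the domain. A weight w that vanishes only on a null set keeps trigonometric
  polynomials dense, although |w| has no positive lower bound, since F / w can be cut off to a
  bounded function at small cost. The exponent \<open>k\<close> has to satisfy r_j + k \<ge> 0 for
  all j: then the j-th power in \<psi> absorbs the singularity of the j-th summand of
  \<open>m\<close>, and the other factors are bounded anyway. The product \<psi> Q is a
  trigonometric polynomial, but m \<psi> Q in general is not. To obtain T u as a sequence one needs
  completeness of the characters, which rests on Stone-Weierstrass. Targets in \<open>ell2\<close>
  are first truncated to finite support, where the transform is an explicit finite sum.\<close>

definition L2 :: "'a measure \<Rightarrow> ('a \<Rightarrow> complex) set" where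
  "L2 M = {F \<in> borel_measurable M. integrable M (\<lambda>x. (cmod (F x))\<^sup>2)}"

definition norm2 :: "'a measure \<Rightarrow> ('a \<Rightarrow> complex) \<Rightarrow> real" where
  "norm2 M F = sqrt (\<integral>x. (cmod (F x))\<^sup>2 \<partial>M)"

definition inner2 :: "'a measure \<Rightarrow> ('a \<Rightarrow> complex) \<Rightarrow> ('a \<Rightarrow> complex) \<Rightarrow> complex" where
  "inner2 M F G = (\<integral>x. F x * cnj (G x) \<partial>M)"

lemma L2_measurable: "F \<in> L2 M \<Longrightarrow> F \<in> borel_measurable M"
  and L2_integrable: "F \<in> L2 M \<Longrightarrow> integrable M (\<lambda>x. (cmod (F x))\<^sup>2)"
  by (auto simp: L2_def)

lemma L2_dominated:
  assumes "G \<in> L2 M" "F \<in> borel_measurable M" "AE x in M. cmod (F x) \<le> cmod (G x)"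
  shows "F \<in> L2 M"
proof -
  have "integrable M (\<lambda>x. (cmod (F x))\<^sup>2)"
  proof (rule Bochner_Integration.integrable_bound[OF L2_integrable[OF assms(1)]])
    show "AE x in M. norm ((cmod (F x))\<^sup>2) \<le> norm ((cmod (G x))\<^sup>2)"
      using assms(3) by eventually_elim (auto intro: power_mono)
  qed (use assms in measurable)
  then show ?thesis using assms by (simp add: L2_def)
qed

lemma cmod_add_square_le: "(cmod (a + b))\<^sup>2 \<le> 2 * (cmod a)\<^sup>2 + 2 * (cmod b)\<^sup>2"
proof -
  have "(cmod (a + b))\<^sup>2 \<le> (cmod a + cmod b)\<^sup>2"
    by (intro power_mono norm_triangle_ineq) auto
  also have "\<dots> \<le> 2 * (cmod a)\<^sup>2 + 2 * (cmod b)\<^sup>2"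
    using zero_le_power2[of "cmod a - cmod b"] by (simp add: power2_eq_square algebra_simps)
  finally show ?thesis .
qed

lemma L2_add:
  assumes "F \<in> L2 M" "G \<in> L2 M"
  shows "(\<lambda>x. F x + G x) \<in> L2 M"
proof -
  note [measurable] = assms[THEN L2_measurable]
  have "integrable M (\<lambda>x. (cmod (F x + G x))\<^sup>2)"
  proof (rule Bochner_Integration.integrable_bound)
    show "integrable M (\<lambda>x. 2 * (cmod (F x))\<^sup>2 + 2 * (cmod (G x))\<^sup>2)"
      using assms[THEN L2_integrable] by simp
    show "AE x in M. norm ((cmod (F x + G x))\<^sup>2) \<le> norm (2 * (cmod (F x))\<^sup>2 + 2 * (cmod (G x))\<^sup>2)"
      using cmod_add_square_le by (auto simp: abs_of_nonneg)
  qed measurable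
  then show ?thesis using assms by (auto simp: L2_def)
qed

lemma L2_cmult: "F \<in> L2 M \<Longrightarrow> (\<lambda>x. c * F x) \<in> L2 M"
  by (auto simp: L2_def norm_mult power_mult_distrib)

lemma L2_diff: "F \<in> L2 M \<Longrightarrow> G \<in> L2 M \<Longrightarrow> (\<lambda>x. F x - G x) \<in> L2 M"
  using L2_add[of F M "\<lambda>x. - 1 * G x"] L2_cmult[of G M "-1"] by simp

lemma L2_zero: "(\<lambda>_. 0) \<in> L2 M"
  by (simp add: L2_def)

lemma borel_measurable_cnj [measurable]: "cnj \<in> borel_measurable borel"
  by (intro borel_measurable_continuous_onI continuous_intros)

lemma integrable_inner2:
  assumes "F \<in> L2 M" "G \<in> L2 M"
  shows "integrable M (\<lambda>x. F x * cnj (G x))" "integrable M (\<lambda>x. cmod (F x) * cmod (G x))"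
proof -
  have *: "cmod a * cmod b \<le> (cmod a)\<^sup>2 + (cmod b)\<^sup>2" for a b
  proof -
    have "2 * (cmod a * cmod b) \<le> (cmod a)\<^sup>2 + (cmod b)\<^sup>2"
      using zero_le_power2[of "cmod a - cmod b"] by (simp add: power2_eq_square algebra_simps)
    then show ?thesis using mult_nonneg_nonneg[OF norm_ge_zero[of a] norm_ge_zero[of b]] by linarith
  qed
  have I: "integrable M (\<lambda>x. (cmod (F x))\<^sup>2 + (cmod (G x))\<^sup>2)"
    using assms by (auto dest: L2_integrable)
  have [measurable]: "F \<in> borel_measurable M" "G \<in> borel_measurable M"
    using assms by (auto dest: L2_measurable)
  show "integrable M (\<lambda>x. F x * cnj (G x))"
    by (rule Bochner_Integration.integrable_bound[OF I])
      (use * in \<open>auto simp: norm_mult abs_of_nonneg\<close>)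
  show "integrable M (\<lambda>x. cmod (F x) * cmod (G x))"
    by (rule Bochner_Integration.integrable_bound[OF I])
      (use * in \<open>auto simp: norm_mult abs_of_nonneg\<close>)
qed

lemma norm2_nonneg: "norm2 M F \<ge> 0"
  and norm2_square: "(norm2 M F)\<^sup>2 = (\<integral>x. (cmod (F x))\<^sup>2 \<partial>M)"
  by (simp_all add: norm2_def)

lemma inner2_self: "inner2 M F F = complex_of_real ((norm2 M F)\<^sup>2)"
  unfolding norm2_square inner2_def complex_norm_square[symmetric] by (simp flip: of_real_power)

lemma inner2_commute: "inner2 M G F = cnj (inner2 M F G)"
  unfolding inner2_def by (subst Bochner_Integration.integral_cnj[symmetric]) (simp add: mult.commute)

lemma inner2_cmult_left: "inner2 M (\<lambda>x. c * F x) G = c * inner2 M F G"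
  by (simp add: inner2_def mult.assoc)

lemma inner2_cmult_right: "inner2 M F (\<lambda>x. c * G x) = cnj c * inner2 M F G"
  by (simp add: inner2_def mult.left_commute)

lemma inner2_add_left:
  "F \<in> L2 M \<Longrightarrow> G \<in> L2 M \<Longrightarrow> H \<in> L2 M \<Longrightarrow>
    inner2 M (\<lambda>x. F x + G x) H = inner2 M F H + inner2 M G H"
  by (simp add: inner2_def distrib_right integrable_inner2)

lemma inner2_add_right:
  "F \<in> L2 M \<Longrightarrow> G \<in> L2 M \<Longrightarrow> H \<in> L2 M \<Longrightarrow>
    inner2 M H (\<lambda>x. F x + G x) = inner2 M H F + inner2 M H G"
  by (simp add: inner2_def distrib_left integrable_inner2)

lemma inner2_diff_left:
  "F \<in> L2 M \<Longrightarrow> G \<in> L2 M \<Longrightarrow> H \<in> L2 M \<Longrightarrow>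
    inner2 M (\<lambda>x. F x - G x) H = inner2 M F H - inner2 M G H"
  by (simp add: inner2_def left_diff_distrib integrable_inner2)

lemma inner2_diff_right:
  "F \<in> L2 M \<Longrightarrow> G \<in> L2 M \<Longrightarrow> H \<in> L2 M \<Longrightarrow>
    inner2 M H (\<lambda>x. F x - G x) = inner2 M H F - inner2 M H G"
  by (simp add: inner2_def right_diff_distrib integrable_inner2)

text \<open>Discriminant argument for the nonnegative quadratic t \<mapsto> \<integral> (t |F| -
  |G|)^2. Working with moduli keeps its coefficients real.\<close>

lemma Cauchy_Schwarz_inner2:
  assumes "F \<in> L2 M" "G \<in> L2 M"
  shows "cmod (inner2 M F G) \<le> norm2 M F * norm2 M G"
proof -
  define a b c where "a = (norm2 M F)\<^sup>2" and "b = (\<integral>x. cmod (F x) * cmod (G x) \<partial>M)"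
    and "c = (norm2 M G)\<^sup>2"
  have q: "a * t\<^sup>2 - 2 * b * t + c \<ge> 0" for t
  proof -
    have "0 \<le> (\<integral>x. (cmod (F x) * t - cmod (G x))\<^sup>2 \<partial>M)" by simp
    also have "\<dots> = (\<integral>x. (cmod (F x))\<^sup>2 * t\<^sup>2 - 2 * t * (cmod (F x) * cmod (G x)) + (cmod (G x))\<^sup>2 \<partial>M)"
      by (rule Bochner_Integration.integral_cong) (auto simp: power2_eq_square algebra_simps)
    also have "\<dots> = a * t\<^sup>2 - 2 * b * t + c"
      using assms by (simp add: a_def b_def c_def norm2_square L2_integrable integrable_inner2)
    finally show ?thesis .
  qed
  have b: "b \<ge> 0" unfolding b_def by simp
  have "b\<^sup>2 \<le> a * c"
  proof (cases "a = 0")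
    case True
    have "b = 0"
    proof (rule ccontr)
      assume "b \<noteq> 0"
      \<comment> \<open>With a = 0 the quadratic is affine in t, and this t gives it the value
        -1.\<close>
      then show False using q[of "(c + 1) / (2 * b)"] True by simp
    qed
    with True show ?thesis by simp
  next
    case False
    then have "a > 0" by (simp add: a_def)
    then show ?thesis using q[of "b / a"] by (simp add: field_simps power2_eq_square)
  qed
  then have "b \<le> norm2 M F * norm2 M G"
    unfolding a_def c_def power_mult_distrib[symmetric]
    by (rule power2_le_imp_le) (simp add: norm2_nonneg)
  moreover have "cmod (inner2 M F G) \<le> b"
    unfolding inner2_def b_def
    by (rule order_trans[OF integral_norm_bound]) (simp add: norm_mult)
  ultimately show ?thesis by linarith
qed

lemma norm2_add_square:
  assumes "F \<in> L2 M" "G \<in> L2 M"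
  shows "(norm2 M (\<lambda>x. F x + G x))\<^sup>2 = (norm2 M F)\<^sup>2 + (norm2 M G)\<^sup>2 + 2 * Re (inner2 M F G)"
proof -
  have "complex_of_real ((norm2 M (\<lambda>x. F x + G x))\<^sup>2)
      = inner2 M F F + inner2 M F G + cnj (inner2 M F G) + inner2 M G G"
    unfolding inner2_self[symmetric]
    using assms by (simp add: inner2_add_left inner2_add_right L2_add inner2_commute[of M G F])
  from arg_cong[OF this, of Re] show ?thesis by (simp add: inner2_self)
qed

lemma norm2_triangle:
  assumes "F \<in> L2 M" "G \<in> L2 M"
  shows "norm2 M (\<lambda>x. F x + G x) \<le> norm2 M F + norm2 M G"
proof (rule power2_le_imp_le)
  have "Re (inner2 M F G) \<le> norm2 M F * norm2 M G"
    using Cauchy_Schwarz_inner2[OF assms] complex_Re_le_cmod[of "inner2 M F G"] by linarith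
  then show "(norm2 M (\<lambda>x. F x + G x))\<^sup>2 \<le> (norm2 M F + norm2 M G)\<^sup>2"
    unfolding norm2_add_square[OF assms] by (simp add: power2_sum)
qed (simp add: norm2_nonneg)

lemma norm2_cmult: "norm2 M (\<lambda>x. c * F x) = cmod c * norm2 M F"
  by (simp add: norm2_def norm_mult power_mult_distrib real_sqrt_mult)

lemma norm2_minus_commute: "norm2 M (\<lambda>x. F x - G x) = norm2 M (\<lambda>x. G x - F x)"
  by (simp add: norm2_def norm_minus_commute)

lemma norm2_triangle_diff:
  assumes "F \<in> L2 M" "G \<in> L2 M" "H \<in> L2 M"
  shows "norm2 M (\<lambda>x. F x - H x) \<le> norm2 M (\<lambda>x. F x - G x) + norm2 M (\<lambda>x. G x - H x)"
  using norm2_triangle[OF L2_diff[OF assms(1,2)] L2_diff[OF assms(2,3)]] by simp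

lemma norm2_mono:
  assumes "G \<in> L2 M" "F \<in> borel_measurable M" "AE x in M. cmod (F x) \<le> cmod (G x)"
  shows "norm2 M F \<le> norm2 M G"
proof -
  have "AE x in M. (cmod (F x))\<^sup>2 \<le> (cmod (G x))\<^sup>2"
    using assms(3) by eventually_elim (auto intro: power_mono)
  then show ?thesis
    unfolding norm2_def
    using integral_mono_AE[OF L2_integrable[OF L2_dominated[OF assms]] L2_integrable[OF assms(1)]]
    by simp
qed

lemma norm2_eq_0_iff:
  assumes "F \<in> L2 M"
  shows "norm2 M F = 0 \<longleftrightarrow> (AE x in M. F x = 0)"
  using integral_nonneg_eq_0_iff_AE[OF L2_integrable[OF assms]] by (simp add: norm2_def)

lemma norm2_dominated_convergence:
  assumes "G \<in> L2 M" "F \<in> borel_measurable M" "\<And>n. Fn n \<in> borel_measurable M"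
    and "\<And>n. AE x in M. cmod (F x - Fn n x) \<le> cmod (G x)"
    and "AE x in M. (\<lambda>n. Fn n x) \<longlonglongrightarrow> F x"
  shows "(\<lambda>n. norm2 M (\<lambda>x. F x - Fn n x)) \<longlonglongrightarrow> 0"
proof -
  have "(\<lambda>n. \<integral>x. (cmod (F x - Fn n x))\<^sup>2 \<partial>M) \<longlonglongrightarrow> (\<integral>x. 0 \<partial>M)"
  proof (rule integral_dominated_convergence)
    show "integrable M (\<lambda>x. (cmod (G x))\<^sup>2)" using assms by (simp add: L2_integrable)
    show "AE x in M. (\<lambda>n. (cmod (F x - Fn n x))\<^sup>2) \<longlonglongrightarrow> 0"
      using assms(5)
    proof eventually_elim
      case (elim x)
      have "(\<lambda>n. (cmod (F x - Fn n x))\<^sup>2) \<longlonglongrightarrow> (cmod (F x - F x))\<^sup>2"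
        by (intro tendsto_intros elim)
      then show ?case by simp
    qed
    show "AE x in M. norm ((cmod (F x - Fn n x))\<^sup>2) \<le> (cmod (G x))\<^sup>2" for n
      using assms(4)[of n] by eventually_elim (auto intro: power_mono)
  qed (use assms(2,3) in measurable)
  from tendsto_real_sqrt[OF this] show ?thesis by (simp add: norm2_def)
qed


section \<open>Square-summable functions\<close>

text \<open>The reason for developing \<open>L2\<close> over an arbitrary measure: with counting
  measure it yields the Hilbert space facts for sequences, with \<open>torus\<close> those for their
  transforms. For nonnegative terms, unconditional summability is integrability.\<close>

lemma ell2_eq_L2: "ell2 = L2 (count_space UNIV)"
proof -
  have "(\<lambda>x. (cmod (f x))\<^sup>2) summable_on UNIV \<longleftrightarrow> integrable (count_space UNIV) (\<lambda>x. (cmod (f x))\<^sup>2)"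
    for f :: "'a \<Rightarrow> complex"
    using abs_summable_equivalent[of "\<lambda>x. (cmod (f x))\<^sup>2" UNIV] by (simp add: abs_summable_on_def)
  then show ?thesis by (auto simp: ell2_def L2_def)
qed

lemma ell2_inner_eq_inner2:
  assumes "f \<in> ell2" "g \<in> ell2"
  shows "ell2_inner f g = inner2 (count_space UNIV) f g"
proof -
  have "Infinite_Set_Sum.abs_summable_on (\<lambda>x. f x * cnj (g x)) UNIV"
    unfolding abs_summable_on_def using assms by (simp add: ell2_eq_L2 integrable_inner2)
  from infsetsum_infsum[OF this] show ?thesis
    by (simp add: ell2_inner_def inner2_def infsetsum_def)
qed

lemma ell2_norm_eq_norm2:
  assumes "f \<in> ell2"
  shows "ell2_norm f = norm2 (count_space UNIV) f"
proof -
  have "Infinite_Set_Sum.abs_summable_on (\<lambda>x. (cmod (f x))\<^sup>2) UNIV"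
    unfolding abs_summable_on_def using assms by (simp add: ell2_eq_L2 L2_integrable)
  from infsetsum_infsum[OF this] show ?thesis
    by (simp add: ell2_norm_def norm2_def infsetsum_def)
qed

lemma ell2_add: "f \<in> ell2 \<Longrightarrow> g \<in> ell2 \<Longrightarrow> (\<lambda>x. f x + g x) \<in> ell2"
  and ell2_diff: "f \<in> ell2 \<Longrightarrow> g \<in> ell2 \<Longrightarrow> (\<lambda>x. f x - g x) \<in> ell2"
  and ell2_cmult: "f \<in> ell2 \<Longrightarrow> (\<lambda>x. c * f x) \<in> ell2"
  and ell2_zero: "(\<lambda>x. 0) \<in> ell2"
  by (simp_all add: ell2_eq_L2 L2_add L2_diff L2_cmult L2_zero)

lemmas ell2_closed = ell2_add ell2_diff ell2_cmult ell2_zero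

lemma ell2_inner_add_left:
  "\<lbrakk>f \<in> ell2; g \<in> ell2; h \<in> ell2\<rbrakk> \<Longrightarrow> ell2_inner (\<lambda>x. f x + g x) h = ell2_inner f h + ell2_inner g h"
  and ell2_inner_diff_left:
  "\<lbrakk>f \<in> ell2; g \<in> ell2; h \<in> ell2\<rbrakk> \<Longrightarrow> ell2_inner (\<lambda>x. f x - g x) h = ell2_inner f h - ell2_inner g h"
  and ell2_inner_diff_right:
  "\<lbrakk>f \<in> ell2; g \<in> ell2; h \<in> ell2\<rbrakk> \<Longrightarrow> ell2_inner h (\<lambda>x. f x - g x) = ell2_inner h f - ell2_inner h g"
  and ell2_inner_add_right:
  "\<lbrakk>f \<in> ell2; g \<in> ell2; h \<in> ell2\<rbrakk> \<Longrightarrow> ell2_inner h (\<lambda>x. f x + g x) = ell2_inner h f + ell2_inner h g"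
  by (simp_all add: ell2_inner_eq_inner2 ell2_closed)
    (simp_all add: ell2_eq_L2 inner2_add_left inner2_diff_left inner2_diff_right inner2_add_right)

lemma ell2_inner_cmult_left:
  "\<lbrakk>f \<in> ell2; g \<in> ell2\<rbrakk> \<Longrightarrow> ell2_inner (\<lambda>x. c * f x) g = c * ell2_inner f g"
  and ell2_inner_cmult_right:
  "\<lbrakk>f \<in> ell2; g \<in> ell2\<rbrakk> \<Longrightarrow> ell2_inner f (\<lambda>x. c * g x) = cnj c * ell2_inner f g"
  by (simp_all add: ell2_inner_eq_inner2 ell2_closed inner2_cmult_left inner2_cmult_right)

lemma ell2_norm_nonneg: "f \<in> ell2 \<Longrightarrow> ell2_norm f \<ge> 0"
  by (simp add: ell2_norm_eq_norm2 norm2_nonneg)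

lemma ell2_inner_self: "f \<in> ell2 \<Longrightarrow> ell2_inner f f = complex_of_real ((ell2_norm f)\<^sup>2)"
  by (simp add: ell2_norm_eq_norm2 ell2_inner_eq_inner2 inner2_self)

lemma Cauchy_Schwarz_ell2:
  "\<lbrakk>f \<in> ell2; g \<in> ell2\<rbrakk> \<Longrightarrow> cmod (ell2_inner f g) \<le> ell2_norm f * ell2_norm g"
  using Cauchy_Schwarz_inner2[of f "count_space UNIV" g]
  by (simp add: ell2_norm_eq_norm2 ell2_inner_eq_inner2 flip: ell2_eq_L2)

lemma ell2_norm_triangle:
  "\<lbrakk>f \<in> ell2; g \<in> ell2\<rbrakk> \<Longrightarrow> ell2_norm (\<lambda>x. f x + g x) \<le> ell2_norm f + ell2_norm g"
  using norm2_triangle[of f "count_space UNIV" g]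
  by (simp add: ell2_norm_eq_norm2 ell2_closed flip: ell2_eq_L2)

lemma ell2_norm_add_square:
  "\<lbrakk>f \<in> ell2; g \<in> ell2\<rbrakk> \<Longrightarrow>
    (ell2_norm (\<lambda>x. f x + g x))\<^sup>2 = (ell2_norm f)\<^sup>2 + (ell2_norm g)\<^sup>2 + 2 * Re (ell2_inner f g)"
  using norm2_add_square[of f "count_space UNIV" g]
  by (simp add: ell2_norm_eq_norm2 ell2_inner_eq_inner2 ell2_closed flip: ell2_eq_L2)

lemma ell2_norm_cmult: "f \<in> ell2 \<Longrightarrow> ell2_norm (\<lambda>x. c * f x) = cmod c * ell2_norm f"
  by (simp add: ell2_norm_eq_norm2 ell2_closed norm2_cmult)

lemma ell2_norm_minus_commute: "ell2_norm (\<lambda>x. f x - g x) = ell2_norm (\<lambda>x. g x - f x)"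
  by (simp add: ell2_norm_def norm_minus_commute)

lemma ell2_norm_triangle_diff:
  "\<lbrakk>f \<in> ell2; g \<in> ell2; h \<in> ell2\<rbrakk> \<Longrightarrow>
    ell2_norm (\<lambda>x. f x - h x) \<le> ell2_norm (\<lambda>x. f x - g x) + ell2_norm (\<lambda>x. g x - h x)"
  using ell2_norm_triangle[of "\<lambda>x. f x - g x" "\<lambda>x. g x - h x"] by (simp add: ell2_closed)

lemma ell2_norm_eq_0_iff: "f \<in> ell2 \<Longrightarrow> ell2_norm f = 0 \<longleftrightarrow> f = (\<lambda>_. 0)"
  using norm2_eq_0_iff[of f "count_space UNIV"]
  by (simp add: ell2_norm_eq_norm2 AE_count_space fun_eq_iff flip: ell2_eq_L2)

lemma ell2_norm_zero: "ell2_norm (\<lambda>_. 0) = 0"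
  by (simp add: ell2_norm_def)

text \<open>Truncation to a large finite set; the squared error is the tail of the series.\<close>

lemma ell2_c_dense:
  fixes f :: "'i \<Rightarrow> complex"
  assumes "f \<in> ell2" "e > 0"
  obtains u where "u \<in> ell2_c" "ell2_norm (\<lambda>x. f x - u x) < e"
proof -
  define s where "s = (\<Sum>\<^sub>\<infinity>x. (cmod (f x))\<^sup>2)"
  have f: "(\<lambda>x. (cmod (f x))\<^sup>2) summable_on UNIV" using assms by (simp add: ell2_def)
  then have "((\<lambda>x. (cmod (f x))\<^sup>2) has_sum s) UNIV" by (simp add: s_def has_sum_infsum)
  then have "\<forall>\<^sub>F A in finite_subsets_at_top UNIV. dist (\<Sum>x\<in>A. (cmod (f x))\<^sup>2) s < e\<^sup>2"
    unfolding has_sum_def by (rule tendstoD) (use assms in simp)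
  then obtain A where A: "finite A" "dist (\<Sum>x\<in>A. (cmod (f x))\<^sup>2) s < e\<^sup>2"
    unfolding eventually_finite_subsets_at_top by blast
  define u where "u = (\<lambda>x. if x \<in> A then f x else 0)"
  have u: "u \<in> ell2_c"
    using A(1) by (auto simp: ell2_c_def u_def elim: rev_finite_subset)
  have "(\<Sum>\<^sub>\<infinity>x. (cmod (f x - u x))\<^sup>2) = (\<Sum>\<^sub>\<infinity>x\<in>UNIV - A. (cmod (f x))\<^sup>2)"
    by (rule infsum_cong_neutral) (auto simp: u_def)
  also have "\<dots> = s - (\<Sum>x\<in>A. (cmod (f x))\<^sup>2)"
    unfolding s_def by (subst infsum_Diff[OF f]) (use A in auto)
  also have "\<dots> < e\<^sup>2" using A(2) by (auto simp: dist_real_def)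
  finally have "ell2_norm (\<lambda>x. f x - u x) < sqrt (e\<^sup>2)"
    unfolding ell2_norm_def by (rule real_sqrt_less_mono)
  then show ?thesis using that u assms(2) by simp
qed


section \<open>A criterion for essential self-adjointness\<close>

lemma op_closure_ell2: "(f, g) \<in> op_closure T \<Longrightarrow> f \<in> ell2" "(f, g) \<in> op_closure T \<Longrightarrow> g \<in> ell2"
  by (auto simp: op_closure_def)

text \<open>Weak inequalities suffice, because the hypothesis can be applied at
  \<open>e / 2\<close>.\<close>

lemma op_closureI:
  assumes "f \<in> ell2" "g \<in> ell2"
    and "\<And>e. e > 0 \<Longrightarrow> \<exists>u v. (u, v) \<in> T \<and> ell2_norm (\<lambda>x. f x - u x) \<le> e \<and> ell2_norm (\<lambda>x. g x - v x) \<le> e"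
  shows "(f, g) \<in> op_closure T"
proof -
  have "\<exists>(u, v)\<in>T. ell2_norm (\<lambda>x. f x - u x) < e \<and> ell2_norm (\<lambda>x. g x - v x) < e" if "e > 0" for e
  proof -
    from that have "e / 2 > 0" "e / 2 < e" by auto
    with assms(3)[of "e / 2"] obtain u v where "(u, v) \<in> T"
        "ell2_norm (\<lambda>x. f x - u x) < e" "ell2_norm (\<lambda>x. g x - v x) < e"
      by (meson le_less_trans)
    then show ?thesis by blast
  qed
  with assms(1,2) show ?thesis by (auto simp: op_closure_def)
qed

lemma op_closureE:
  assumes "(f, g) \<in> op_closure T" "e > 0"
  obtains u v where "(u, v) \<in> T" "ell2_norm (\<lambda>x. f x - u x) < e" "ell2_norm (\<lambda>x. g x - v x) < e"
  using assms unfolding op_closure_def by blast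

lemma op_closure_superset: "T \<subseteq> ell2 \<times> ell2 \<Longrightarrow> T \<subseteq> op_closure T"
  by (force simp: op_closure_def ell2_norm_zero)

lemma op_closure_mono: "S \<subseteq> T \<Longrightarrow> op_closure S \<subseteq> op_closure T"
  by (fastforce simp: op_closure_def)

lemma op_adjoint_antimono: "S \<subseteq> T \<Longrightarrow> op_adjoint T \<subseteq> op_adjoint S"
  by (fastforce simp: op_adjoint_def)

lemma op_closure_add:
  assumes "linear_operator T" "(f, g) \<in> op_closure T" "(f', g') \<in> op_closure T"
  shows "((\<lambda>x. f x + f' x), (\<lambda>x. g x + g' x)) \<in> op_closure T"
proof (rule op_closureI)
  have T: "T \<subseteq> ell2 \<times> ell2" using assms(1) by (auto simp: linear_operator_def)
  note F = op_closure_ell2[OF assms(2)] op_closure_ell2[OF assms(3)]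
  show "(\<lambda>x. f x + f' x) \<in> ell2" "(\<lambda>x. g x + g' x) \<in> ell2" using F by (simp_all add: ell2_closed)
  fix e :: real assume e: "e > 0"
  obtain u v where uv: "(u, v) \<in> T" "ell2_norm (\<lambda>x. f x - u x) < e/2" "ell2_norm (\<lambda>x. g x - v x) < e/2"
    using op_closureE[OF assms(2), of "e/2"] e by auto
  obtain u' v' where uv': "(u', v') \<in> T" "ell2_norm (\<lambda>x. f' x - u' x) < e/2" "ell2_norm (\<lambda>x. g' x - v' x) < e/2"
    using op_closureE[OF assms(3), of "e/2"] e by auto
  have *: "ell2_norm (\<lambda>x. a x + a' x - (b x + b' x)) \<le> e"
    if "a \<in> ell2" "a' \<in> ell2" "b \<in> ell2" "b' \<in> ell2"
       "ell2_norm (\<lambda>x. a x - b x) < e/2" "ell2_norm (\<lambda>x. a' x - b' x) < e/2" for a a' b b' :: "'a \<Rightarrow> complex"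
    using ell2_norm_triangle[OF ell2_diff[OF that(1,3)] ell2_diff[OF that(2,4)]] that(5,6)
    by (simp add: algebra_simps)
  have "((\<lambda>x. u x + u' x), (\<lambda>x. v x + v' x)) \<in> T"
    using assms(1) uv uv' by (auto simp: linear_operator_def)
  moreover have "ell2_norm (\<lambda>x. f x + f' x - (u x + u' x)) \<le> e" "ell2_norm (\<lambda>x. g x + g' x - (v x + v' x)) \<le> e"
    using F T uv uv' by (auto intro!: *)
  ultimately show "\<exists>u v. (u, v) \<in> T \<and> ell2_norm (\<lambda>x. f x + f' x - u x) \<le> e \<and>
      ell2_norm (\<lambda>x. g x + g' x - v x) \<le> e" by blast
qed

lemma op_closure_cmult:
  assumes "linear_operator T" "(f, g) \<in> op_closure T"
  shows "((\<lambda>x. c * f x), (\<lambda>x. c * g x)) \<in> op_closure T"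
proof (rule op_closureI)
  have T: "T \<subseteq> ell2 \<times> ell2" using assms(1) by (auto simp: linear_operator_def)
  note F = op_closure_ell2[OF assms(2)]
  show "(\<lambda>x. c * f x) \<in> ell2" "(\<lambda>x. c * g x) \<in> ell2" using F by (simp_all add: ell2_closed)
  fix e :: real assume e: "e > 0"
  define d where "d = e / (cmod c + 1)"
  have c: "cmod c + 1 > 0" using norm_ge_zero[of c] by linarith
  then have d: "d > 0" "cmod c * d \<le> e"
    using e by (auto simp: d_def field_simps)
  obtain u v where uv: "(u, v) \<in> T" "ell2_norm (\<lambda>x. f x - u x) < d" "ell2_norm (\<lambda>x. g x - v x) < d"
    using op_closureE[OF assms(2) d(1)] by auto
  have *: "ell2_norm (\<lambda>x. c * a x - c * b x) \<le> e"
    if "a \<in> ell2" "b \<in> ell2" "ell2_norm (\<lambda>x. a x - b x) < d" for a b :: "'a \<Rightarrow> complex"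
  proof -
    have "ell2_norm (\<lambda>x. c * a x - c * b x) = cmod c * ell2_norm (\<lambda>x. a x - b x)"
      using ell2_norm_cmult[OF ell2_diff[OF that(1,2)], of c] by (simp add: algebra_simps)
    also have "\<dots> \<le> cmod c * d" using that by (intro mult_left_mono) auto
    finally show ?thesis using d by linarith
  qed
  have "((\<lambda>x. c * u x), (\<lambda>x. c * v x)) \<in> T"
    using assms(1) uv by (auto simp: linear_operator_def)
  moreover have "ell2_norm (\<lambda>x. c * f x - c * u x) \<le> e" "ell2_norm (\<lambda>x. c * g x - c * v x) \<le> e"
    using F T uv by (auto intro!: *)
  ultimately show "\<exists>u v. (u, v) \<in> T \<and> ell2_norm (\<lambda>x. c * f x - u x) \<le> e \<and>
      ell2_norm (\<lambda>x. c * g x - v x) \<le> e" by blast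
qed

text \<open>Both sides are continuous in the pair (f, g), so the identity passes to limits. The
  approximants are taken jointly because they will be elements of a graph.\<close>

lemma ell2_inner_eq_by_approximation:
  assumes "u \<in> ell2" "v \<in> ell2" "f \<in> ell2" "g \<in> ell2"
    and "\<And>e. e > 0 \<Longrightarrow> \<exists>f'\<in>ell2. \<exists>g'\<in>ell2. ell2_inner v f' = ell2_inner u g' \<and>
      ell2_norm (\<lambda>x. f x - f' x) < e \<and> ell2_norm (\<lambda>x. g x - g' x) < e"
  shows "ell2_inner v f = ell2_inner u g"
proof (rule ccontr)
  assume ne: "ell2_inner v f \<noteq> ell2_inner u g"
  define k where "k = ell2_norm v + ell2_norm u + 1"
  have k: "k > 0" using assms(1,2) by (simp add: k_def ell2_norm_nonneg add_nonneg_pos)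
  \<comment> \<open>Chosen so that \<open>k * e\<close> is the gap between the two sides; the
    summand 1 in \<open>k\<close> makes the resulting bound on the gap strict.\<close>
  define e where "e = cmod (ell2_inner v f - ell2_inner u g) / k"
  have "e > 0" using ne k by (simp add: e_def)
  then obtain f' g' where f': "f' \<in> ell2" "g' \<in> ell2" "ell2_inner v f' = ell2_inner u g'"
      "ell2_norm (\<lambda>x. f x - f' x) < e" "ell2_norm (\<lambda>x. g x - g' x) < e"
    using assms(5) by blast
  have "ell2_inner v f - ell2_inner u g
      = ell2_inner v (\<lambda>x. f x - f' x) - ell2_inner u (\<lambda>x. g x - g' x)"
    using assms f' by (simp add: ell2_inner_diff_right)
  then have "cmod (ell2_inner v f - ell2_inner u g)
      \<le> cmod (ell2_inner v (\<lambda>x. f x - f' x)) + cmod (ell2_inner u (\<lambda>x. g x - g' x))"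
    using norm_triangle_ineq4 by simp
  also have "\<dots> \<le> ell2_norm v * ell2_norm (\<lambda>x. f x - f' x) + ell2_norm u * ell2_norm (\<lambda>x. g x - g' x)"
    using assms f' by (intro add_mono Cauchy_Schwarz_ell2) (auto simp: ell2_closed)
  also have "\<dots> \<le> ell2_norm v * e + ell2_norm u * e"
    using assms f' by (intro add_mono mult_left_mono) (auto simp: ell2_norm_nonneg)
  also have "\<dots> < k * e" using \<open>e > 0\<close> by (simp add: k_def algebra_simps)
  also have "\<dots> = cmod (ell2_inner v f - ell2_inner u g)" using k by (simp add: e_def)
  finally show False by simp
qed

section \<open>Adjoints and closures of graphs\<close>

lemma ell2_inner_commute: "\<lbrakk>f \<in> ell2; g \<in> ell2\<rbrakk> \<Longrightarrow> ell2_inner g f = cnj (ell2_inner f g)"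
  by (simp add: ell2_inner_eq_inner2 inner2_commute[of _ g f])

text \<open>Conjugation moves \<open>u\<close> and \<open>v\<close> into the right argument, the one
  that \<open>ell2_inner_eq_by_approximation\<close> varies. This makes that lemma applicable to
  elements of the closure of \<open>T\<close>.\<close>

lemma op_adjoint_iff_inner_left:
  assumes "T \<subseteq> ell2 \<times> ell2"
  shows "(f, g) \<in> op_adjoint T \<longleftrightarrow>
    f \<in> ell2 \<and> g \<in> ell2 \<and> (\<forall>(u, v)\<in>T. ell2_inner f v = ell2_inner g u)"
proof -
  have "(ell2_inner v f = ell2_inner u g) = (ell2_inner f v = ell2_inner g u)"
    if "f \<in> ell2" "g \<in> ell2" "(u, v) \<in> T" for u v
  proof -
    have "u \<in> ell2" "v \<in> ell2" using assms that by auto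
    then show ?thesis using that ell2_inner_commute[of f v] ell2_inner_commute[of g u] by simp
  qed
  then show ?thesis by (auto simp: op_adjoint_def)
qed

text \<open>Each (u, v) in \<open>T\<close> imposes a closed condition on (f, g).\<close>

lemma op_adjoint_closed:
  assumes "T \<subseteq> ell2 \<times> ell2"
  shows "op_closure (op_adjoint T) \<subseteq> op_adjoint T"
proof safe
  fix f g assume fg: "(f, g) \<in> op_closure (op_adjoint T)"
  have "ell2_inner v f = ell2_inner u g" if "(u, v) \<in> T" for u v
  proof (rule ell2_inner_eq_by_approximation)
    fix e :: real assume "e > 0"
    then obtain f' g' where "(f', g') \<in> op_adjoint T" "ell2_norm (\<lambda>x. f x - f' x) < e"
        "ell2_norm (\<lambda>x. g x - g' x) < e"
      using op_closureE[OF fg] by blast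
    with that show "\<exists>f'\<in>ell2. \<exists>g'\<in>ell2. ell2_inner v f' = ell2_inner u g' \<and>
      ell2_norm (\<lambda>x. f x - f' x) < e \<and> ell2_norm (\<lambda>x. g x - g' x) < e"
      unfolding op_adjoint_def by blast
  qed (use that assms op_closure_ell2[OF fg] in auto)
  then show "(f, g) \<in> op_adjoint T"
    using op_closure_ell2[OF fg] by (auto simp: op_adjoint_def)
qed

text \<open>Conversely, each (f, g) in the adjoint is a closed condition on (u, v), so it extends
  from \<open>T\<close> to its closure.\<close>

lemma op_adjoint_op_closure:
  assumes "T \<subseteq> ell2 \<times> ell2"
  shows "op_adjoint (op_closure T) = op_adjoint T"
proof
  show "op_adjoint (op_closure T) \<subseteq> op_adjoint T"
    by (intro op_adjoint_antimono op_closure_superset assms)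
  show "op_adjoint T \<subseteq> op_adjoint (op_closure T)"
  proof safe
    fix f g assume fg: "(f, g) \<in> op_adjoint T"
    then have fg2: "f \<in> ell2" "g \<in> ell2" by (auto simp: op_adjoint_def)
    have "ell2_inner g u = ell2_inner f v" if uv: "(u, v) \<in> op_closure T" for u v
    proof (rule ell2_inner_eq_by_approximation)
      fix e :: real assume "e > 0"
      then obtain u' v' where u': "(u', v') \<in> T" "ell2_norm (\<lambda>x. u x - u' x) < e"
          "ell2_norm (\<lambda>x. v x - v' x) < e"
        using op_closureE[OF uv] by blast
      moreover have "ell2_inner g u' = ell2_inner f v'"
        using fg u'(1) op_adjoint_iff_inner_left[OF assms] by fastforce
      ultimately show "\<exists>u'\<in>ell2. \<exists>v'\<in>ell2. ell2_inner g u' = ell2_inner f v' \<and>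
        ell2_norm (\<lambda>x. u x - u' x) < e \<and> ell2_norm (\<lambda>x. v x - v' x) < e"
        using assms by blast
    qed (use fg2 op_closure_ell2[OF uv] in auto)
    moreover have "op_closure T \<subseteq> ell2 \<times> ell2" by (auto simp: op_closure_def)
    ultimately show "(f, g) \<in> op_adjoint (op_closure T)"
      using fg2 by (auto simp: op_adjoint_iff_inner_left)
  qed
qed

text \<open>The difference \<open>h\<close> of two values is orthogonal to the dense domain, hence
  to itself.\<close>

lemma op_adjoint_single_valued:
  assumes "T \<subseteq> ell2 \<times> ell2" "densely_defined T"
  shows "single_valued (op_adjoint T)"
proof (rule single_valuedI)
  fix f g g' assume *: "(f, g) \<in> op_adjoint T" "(f, g') \<in> op_adjoint T"
  then have f: "f \<in> ell2" "g \<in> ell2" "g' \<in> ell2" by (auto simp: op_adjoint_def)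
  define h where "h = (\<lambda>x. g x - g' x)"
  have h: "h \<in> ell2" using f by (simp add: h_def ell2_closed)
  have orth: "ell2_inner h u = 0" if "u \<in> Domain T" for u
  proof -
    from that obtain v where uv: "(u, v) \<in> T" by auto
    then have "ell2_inner g u = ell2_inner g' u"
      using * op_adjoint_iff_inner_left[OF assms(1)] by fastforce
    moreover have "u \<in> ell2" using uv assms by auto
    ultimately show ?thesis using f by (simp add: h_def ell2_inner_diff_left)
  qed
  \<comment> \<open>The approximation lemma with a zero second pair: \<open>h\<close> is a limit of
    elements \<open>u\<close> with <h, u> = 0.\<close>
  have "ell2_inner h h = ell2_inner (\<lambda>_::'a. 0) (\<lambda>_::'a. 0)"
  proof (rule ell2_inner_eq_by_approximation)
    fix e :: real assume e: "e > 0"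
    then obtain u where u: "u \<in> Domain T" "ell2_norm (\<lambda>x. h x - u x) < e"
      using assms(2) h unfolding densely_defined_def by blast
    have "ell2_inner h u = ell2_inner (\<lambda>_::'a. 0) (\<lambda>_::'a. 0)"
      using orth[OF u(1)] by (simp add: ell2_inner_def)
    moreover have "ell2_norm (\<lambda>x::'a. 0 - 0) < e" using e by (simp add: ell2_norm_zero)
    moreover have "u \<in> ell2" using u assms by auto
    ultimately show "\<exists>u\<in>ell2. \<exists>g'\<in>ell2. ell2_inner h u = ell2_inner (\<lambda>_::'a. 0) g' \<and>
        ell2_norm (\<lambda>x. h x - u x) < e \<and> ell2_norm (\<lambda>x. 0 - g' x) < e"
      using u(2) by (intro bexI[of _ u] bexI[of _ "\<lambda>_. 0"] conjI ell2_zero)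
  qed (simp_all add: h ell2_zero)
  also have "\<dots> = 0" by (simp add: ell2_inner_def)
  finally have "ell2_norm h = 0" using h by (simp add: ell2_inner_self)
  then have "h = (\<lambda>_. 0)" using h by (simp add: ell2_norm_eq_0_iff)
  then show "g = g'" by (auto simp: h_def fun_eq_iff)
qed

text \<open>The cross term is twice the real part of \<open>cnj c * ell2_inner v u\<close>. It
  vanishes since symmetry makes the inner product real while \<open>c\<close> is imaginary.\<close>

lemma symmetric_operator_norm_add_ii:
  assumes "symmetric_operator T" "(u, v) \<in> T" "c = \<i> \<or> c = - \<i>"
  shows "(ell2_norm (\<lambda>x. v x + c * u x))\<^sup>2 = (ell2_norm v)\<^sup>2 + (ell2_norm u)\<^sup>2"
proof -
  have uv: "u \<in> ell2" "v \<in> ell2"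
    using assms by (auto simp: symmetric_operator_def linear_operator_def)
  have "ell2_inner v u = ell2_inner u v"
    using assms by (fastforce simp: symmetric_operator_def)
  also have "\<dots> = cnj (ell2_inner v u)" using uv by (rule ell2_inner_commute[rotated])
  finally have "Im (ell2_inner v u) = 0"
    by (metis cnj.sel(2) equal_neg_zero)
  moreover have "cmod c = 1" using assms(3) by auto
  moreover have "ell2_inner v (\<lambda>x. c * u x) = cnj c * ell2_inner v u"
    using uv by (rule ell2_inner_cmult_right[rotated])
  ultimately show ?thesis
    using assms(3) ell2_norm_add_square[OF uv(2) ell2_cmult[OF uv(1), of c]] ell2_norm_cmult[OF uv(1), of c]
    by (elim disjE) simp_all
qed

lemma symmetric_operator_norm_le:
  assumes "symmetric_operator T" "(u, v) \<in> T" "c = \<i> \<or> c = - \<i>"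
  shows "ell2_norm u \<le> ell2_norm (\<lambda>x. v x + c * u x)" "ell2_norm v \<le> ell2_norm (\<lambda>x. v x + c * u x)"
proof -
  have uv: "u \<in> ell2" "v \<in> ell2"
    using assms by (auto simp: symmetric_operator_def linear_operator_def)
  then have "ell2_norm (\<lambda>x. v x + c * u x) \<ge> 0" by (intro ell2_norm_nonneg) (simp add: ell2_closed)
  moreover have "(ell2_norm u)\<^sup>2 \<le> (ell2_norm (\<lambda>x. v x + c * u x))\<^sup>2"
      "(ell2_norm v)\<^sup>2 \<le> (ell2_norm (\<lambda>x. v x + c * u x))\<^sup>2"
    unfolding symmetric_operator_norm_add_ii[OF assms] by simp_all
  ultimately show "ell2_norm u \<le> ell2_norm (\<lambda>x. v x + c * u x)"
      "ell2_norm v \<le> ell2_norm (\<lambda>x. v x + c * u x)"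
    by (blast intro: power2_le_imp_le)+
qed

text \<open>
  The usual deficiency criterion, arranged so that completeness of \<^const>\<open>ell2\<close> is not needed:
  for \<open>(f, g)\<close> in the adjoint and \<open>(u, v)\<close> in \<open>T\<close> with \<open>v + \<i> u\<close> close to \<open>g + \<i> f\<close>, pairing
  \<open>f - u\<close> with the dense range of \<open>T - \<i>\<close> shows that \<open>u\<close> is close to \<open>f\<close>.
\<close>

lemma essentially_self_adjoint_if_dense_range:
  assumes sym: "symmetric_operator T"
    and dense: "\<And>c h e. c = \<i> \<or> c = - \<i> \<Longrightarrow> h \<in> ell2 \<Longrightarrow> e > 0 \<Longrightarrow>
      \<exists>(u, v)\<in>T. ell2_norm (\<lambda>x. h x - (v x + c * u x)) < e"
  shows "essentially_self_adjoint T"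
proof -
  have lin: "linear_operator T" and dd: "densely_defined T"
    using sym by (auto simp: symmetric_operator_def)
  have T: "T \<subseteq> ell2 \<times> ell2" and T0: "((\<lambda>_. 0), (\<lambda>_. 0)) \<in> T"
    using lin by (auto simp: linear_operator_def)
  have "T \<subseteq> op_adjoint T"
    using sym T by (fastforce simp: symmetric_operator_def op_adjoint_def)
  then have sub: "op_closure T \<subseteq> op_adjoint T"
    using op_closure_mono op_adjoint_closed[OF T] by blast
  \<comment> \<open>The closure of a single-valued graph may fail to be single-valued; here this is
    inherited from the adjoint.\<close>
  have sv: "single_valued (op_closure T)"
    using op_adjoint_single_valued[OF T dd] sub by (rule single_valued_subset[rotated])
  have "linear_operator (op_closure T)"
    unfolding linear_operator_def
    using sv op_closure_superset[OF T] T0 op_closure_add[OF lin] op_closure_cmult[OF lin]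
    by (auto dest: op_closure_ell2)
  moreover have "densely_defined (op_closure T)"
    using dd op_closure_superset[OF T] unfolding densely_defined_def by (meson Domain_mono subsetD)
  moreover have "op_adjoint T \<subseteq> op_closure T"
  proof safe
    fix f g assume fg: "(f, g) \<in> op_adjoint T"
    then have fg2: "f \<in> ell2" "g \<in> ell2" by (auto simp: op_adjoint_def)
    show "(f, g) \<in> op_closure T"
    proof (rule op_closureI[OF fg2])
      fix e :: real assume e: "e > 0"
      obtain u v where uv: "(u, v) \<in> T" "ell2_norm (\<lambda>x. (g x + \<i> * f x) - (v x + \<i> * u x)) < e / 2"
        using dense[of \<i> "\<lambda>x. g x + \<i> * f x" "e / 2"] e fg2 by (auto simp: ell2_closed)
      have uv2: "u \<in> ell2" "v \<in> ell2" using uv T by auto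
      define a b where "a = (\<lambda>x. f x - u x)" and "b = (\<lambda>x. g x - v x)"
      define k where "k = (\<lambda>x. b x + \<i> * a x)"
      have ab: "a \<in> ell2" "b \<in> ell2" "k \<in> ell2"
        using fg2 uv2 by (simp_all add: a_def b_def k_def ell2_closed)
      have k: "ell2_norm k < e / 2"
        using uv(2) by (simp add: k_def a_def b_def algebra_simps)
      have adj: "ell2_inner v' a = ell2_inner u' b" if "(u', v') \<in> T" for u' v'
      proof -
        have "ell2_inner v' f = ell2_inner u' g" using fg that by (auto simp: op_adjoint_def)
        moreover have "ell2_inner v' u = ell2_inner u' v"
          using sym that uv(1) by (fastforce simp: symmetric_operator_def)
        moreover have "u' \<in> ell2" "v' \<in> ell2" using T that by auto
        ultimately show ?thesis using fg2 uv2 by (simp add: a_def b_def ell2_inner_diff_right)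
      qed
      \<comment> \<open>If \<open>a\<close> were exactly w = (T - i) u', then |a|^2 = <w, a> = <u',
        k> \<le> |u'| |k| \<le> |a| |k|, the last step because |u'| \<le> |w|. The proof tracks the
        error of approximating \<open>a\<close> by such a \<open>w\<close>.\<close>
      have a: "ell2_norm a \<le> ell2_norm k"
      proof (rule ccontr)
        assume "\<not> ell2_norm a \<le> ell2_norm k"
        then have gt: "ell2_norm a > ell2_norm k" by simp
        define A K where "A = ell2_norm a" and "K = ell2_norm k"
        have AK: "A > K" "K \<ge> 0" using gt ab by (auto simp: A_def K_def ell2_norm_nonneg)
        \<comment> \<open>The estimate below ends in A A \<le> d (A + K) + A K. This
          \<open>d\<close> makes the error d (A + K) half of the gap A A - A K, which contradicts A
          > K.\<close>
        define d where "d = A * (A - K) / (2 * (A + K))"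
        have d: "d > 0" using AK by (simp add: d_def)
        obtain u' v' where u': "(u', v') \<in> T" "ell2_norm (\<lambda>x. a x - (v' x + - \<i> * u' x)) < d"
          using dense[of "- \<i>" a d] ab d by auto
        define w where "w = (\<lambda>x. v' x + - \<i> * u' x)"
        have u'2: "u' \<in> ell2" "v' \<in> ell2" using u' T by auto
        then have w: "w \<in> ell2" unfolding w_def by (intro ell2_closed)
        \<comment> \<open>Formally <(T - i) u', a> = <u', (T* + i) a>: by \<open>adj\<close> the
          pair (a, b) belongs to the adjoint, and k = b + i a.\<close>
        have "ell2_inner w a = ell2_inner v' a + ell2_inner (\<lambda>x. - \<i> * u' x) a"
          unfolding w_def by (intro ell2_inner_add_left ell2_cmult u'2 ab)
        also have "\<dots> = ell2_inner u' b + - \<i> * ell2_inner u' a"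
          by (simp only: ell2_inner_cmult_left[OF u'2(1) ab(1)] adj[OF u'(1)])
        also have "\<dots> = ell2_inner u' b + ell2_inner u' (\<lambda>x. \<i> * a x)"
          by (simp only: ell2_inner_cmult_right[OF u'2(1) ab(1)] complex_cnj_i)
        also have "\<dots> = ell2_inner u' k"
          unfolding k_def by (intro ell2_inner_add_right[symmetric] ell2_cmult u'2 ab)
        finally have wa: "ell2_inner w a = ell2_inner u' k" .
        have "cmod (ell2_inner (\<lambda>x. a x - w x) a) \<le> ell2_norm (\<lambda>x. a x - w x) * A"
          unfolding A_def using ab w by (intro Cauchy_Schwarz_ell2 ell2_diff)
        also have "\<dots> \<le> d * A" using u'(2) AK by (intro mult_right_mono) (auto simp: w_def)
        finally have 1: "cmod (ell2_inner (\<lambda>x. a x - w x) a) \<le> d * A" .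
        have "ell2_norm u' \<le> ell2_norm w"
          unfolding w_def by (intro symmetric_operator_norm_le(1)[OF sym u'(1)] disjI2 refl)
        also have "ell2_norm w \<le> ell2_norm (\<lambda>x. w x - a x) + ell2_norm a"
          using ell2_norm_triangle[OF ell2_diff[OF w ab(1)] ab(1)] by simp
        also have "ell2_norm (\<lambda>x. w x - a x) = ell2_norm (\<lambda>x. a x - w x)"
          by (rule ell2_norm_minus_commute)
        finally have 2: "ell2_norm u' \<le> A + d" using u'(2) unfolding A_def w_def by linarith
        have "cmod (ell2_inner w a) \<le> ell2_norm u' * K"
          unfolding wa K_def using u'2 ab by (intro Cauchy_Schwarz_ell2)
        also have "\<dots> \<le> (A + d) * K" using 2 AK by (intro mult_right_mono)
        finally have 3: "cmod (ell2_inner w a) \<le> (A + d) * K" .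
        have "A * A = cmod (ell2_inner a a)"
          using ab(1) by (simp add: ell2_inner_self A_def norm_power power2_eq_square norm_mult ell2_norm_nonneg)
        also have "ell2_inner a a = ell2_inner (\<lambda>x. a x - w x) a + ell2_inner w a"
          using ab(1) w by (simp add: ell2_inner_diff_left)
        finally have "A * A \<le> d * A + (A + d) * K"
          using 1 3 norm_triangle_ineq[of "ell2_inner (\<lambda>x. a x - w x) a" "ell2_inner w a"] by linarith
        moreover have "d * (2 * (A + K)) = A * (A - K)" using AK by (simp add: d_def)
        ultimately have "A * A \<le> A * K" by (simp add: algebra_simps)
        then show False using AK by simp
      qed
      have "ell2_norm b \<le> e"
      proof -
        have "b = (\<lambda>x. k x + - \<i> * a x)" by (simp add: k_def)
        then have "ell2_norm b \<le> ell2_norm k + ell2_norm (\<lambda>x. - \<i> * a x)"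
          using ell2_norm_triangle[OF ab(3) ell2_cmult[OF ab(1), of "- \<i>"]] by simp
        also have "ell2_norm (\<lambda>x. - \<i> * a x) = ell2_norm a"
          using ell2_norm_cmult[OF ab(1), of "- \<i>"] by simp
        finally show ?thesis using a k by linarith
      qed
      then show "\<exists>u v. (u, v) \<in> T \<and> ell2_norm (\<lambda>x. f x - u x) \<le> e \<and> ell2_norm (\<lambda>x. g x - v x) \<le> e"
        using uv(1) a k e unfolding a_def b_def by (intro exI[of _ u] exI[of _ v]) auto
    qed
  qed
  ultimately show ?thesis
    using sub sym op_adjoint_op_closure[OF T]
    by (auto simp: essentially_self_adjoint_def self_adjoint_def)
qed


section \<open>Fourier series on the torus\<close>

lemma borel_measurable_torusI: "F \<in> borel_measurable borel \<Longrightarrow> F \<in> borel_measurable torus"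
  unfolding torus_def by (intro measurable_restrict_space1) simp

lemma finite_measure_torus: "finite_measure (torus :: (real ^ 'd) measure)"
  by (rule finite_measureI) (simp add: torus_def space_restrict_space emeasure_restrict_space
    emeasure_lborel_cbox_eq)

lemma L2_torus_eq_L2: "L2_torus = L2 torus"
  by (simp add: L2_torus_def L2_def)

lemma (in finite_measure) L2_bounded:
  assumes "F \<in> borel_measurable M" "AE x in M. cmod (F x) \<le> B"
  shows "F \<in> L2 M"
proof (rule L2_dominated[of "\<lambda>_. complex_of_real B"])
  show "AE x in M. cmod (F x) \<le> cmod (complex_of_real B)" using assms(2) by eventually_elim simp
qed (use assms in \<open>auto simp: L2_def\<close>)

section \<open>Characters and their orthogonality\<close>

definition character :: "int ^ 'd \<Rightarrow> real ^ 'd \<Rightarrow> complex" where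
  "character n \<theta> = cis (- (\<Sum>j\<in>UNIV. of_int (n $ j) * \<theta> $ j))"

lemma fourier_sum_eq_characters:
  "fourier_sum f A \<theta> = complex_of_real (1 / sqrt ((2 * pi) ^ CARD('d))) *
     (\<Sum>n\<in>A. f n * character n (\<theta> :: real ^ 'd))"
  by (simp add: fourier_sum_def character_def)

lemma character_mult: "character n \<theta> * character m \<theta> = character (n + m) \<theta>"
  by (simp add: character_def cis_mult distrib_right sum.distrib)

lemma cnj_character: "cnj (character n \<theta>) = character (- n) \<theta>"
  by (simp add: character_def cis_cnj sum_negf)

lemma continuous_on_character: "continuous_on A (character n)"
  unfolding character_def cis_conv_exp by (intro continuous_intros)

lemma character_L2: "character n \<in> L2 torus"
  using L2_torus_continuous[OF continuous_on_character] by (simp add: L2_torus_eq_L2)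

text \<open>Fubini for a product of functions of single coordinates. \<open>lborel\<close> on a
  Euclidean space is the image of a product measure indexed by \<open>Basis\<close>, so the
  coordinates have to be renamed to basis vectors.\<close>

lemma integral_lborel_prod_cart:
  fixes f :: "'d::finite \<Rightarrow> real \<Rightarrow> complex"
  assumes f: "\<And>j. integrable lborel (f j)"
  shows "(\<integral>x. (\<Prod>j\<in>UNIV. f j (x $ j)) \<partial>(lborel :: (real ^ 'd) measure)) = (\<Prod>j\<in>UNIV. \<integral>t. f j t \<partial>lborel)"
proof -
  interpret product_sigma_finite "\<lambda>_::real ^ 'd. lborel :: real measure" ..
  have Basis: "(Basis :: (real ^ 'd) set) = (\<lambda>j. axis j 1) ` UNIV" and inj: "inj (\<lambda>j::'d. axis j (1::real))"
    by (auto simp: Basis_vec_def inj_def axis_eq_axis)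
  \<comment> \<open>Reindexes \<open>f\<close> by basis vectors; the description operator inverts
    the injection from j to \<open>axis j 1\<close>.\<close>
  define g where "g b = f (THE j. b = axis j (1::real))" for b
  have g: "g (axis j 1) = f j" for j
    by (simp add: g_def axis_eq_axis)
  have prod: "(\<Prod>j\<in>UNIV. f j (x $ j)) = (\<Prod>b\<in>Basis. g b (x \<bullet> b))" for x
    unfolding Basis prod.reindex[OF inj] by (simp add: g inner_axis)
  have meas: "(\<lambda>x. \<Prod>b\<in>Basis. g b (x \<bullet> b)) \<in> borel_measurable (borel :: (real ^ 'd) measure)"
    unfolding prod[symmetric]
    by (intro borel_measurable_prod measurable_compose[OF _ borel_measurable_integrable[OF f, simplified]]
      borel_measurable_nth)
  have "(\<integral>x. (\<Prod>j\<in>UNIV. f j (x $ j)) \<partial>(lborel :: (real ^ 'd) measure))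
      = (\<integral>x. (\<Prod>b\<in>Basis. g b ((\<Sum>b\<in>Basis. x b *\<^sub>R b) \<bullet> b)) \<partial>Pi\<^sub>M (Basis :: (real ^ 'd) set) (\<lambda>_. lborel))"
    unfolding prod by (subst lborel_eq, subst integral_distr) (use meas in auto)
  also have "\<dots> = (\<integral>x. (\<Prod>b\<in>Basis. g b (x b)) \<partial>Pi\<^sub>M (Basis :: (real ^ 'd) set) (\<lambda>_. lborel))"
    by (intro Bochner_Integration.integral_cong prod.cong refl) (simp add: inner_sum_left_Basis)
  also have "\<dots> = (\<Prod>b\<in>Basis. \<integral>t. g b t \<partial>lborel)"
    by (rule product_integral_prod) (auto simp: Basis g f)
  also have "\<dots> = (\<Prod>j\<in>UNIV. \<integral>t. f j t \<partial>lborel)"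
    unfolding Basis prod.reindex[OF inj] by (simp add: g)
  finally show ?thesis .
qed

lemma has_bochner_integral_cis_multiple:
  fixes k :: int
  shows "has_bochner_integral lborel (\<lambda>t. indicator {-pi..pi} t *\<^sub>R cis (- (of_int k * t)))
    (if k = 0 then complex_of_real (2 * pi) else 0)"
proof (cases "k = 0")
  case True
  have "has_bochner_integral lborel (\<lambda>t. indicator {-pi..pi} t *\<^sub>R (1::complex)) (of_real pi - of_real (- pi))"
    by (rule has_bochner_integral_FTC_Icc) (auto intro!: derivative_eq_intros)
  with True show ?thesis by simp
next
  case False
  define F where "F t = \<i> / of_int k * cis (- (of_int k * t))" for t :: real
  have "has_bochner_integral lborel (\<lambda>t. indicator {-pi..pi} t *\<^sub>R cis (- (of_int k * t))) (F pi - F (- pi))"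
  proof (rule has_bochner_integral_FTC_Icc)
    show "(F has_vector_derivative cis (- (of_int k * x))) (at x within {-pi..pi})" for x
    proof -
      have "((\<lambda>z. \<i> / of_int k * exp (- (\<i> * of_int k * z))) has_field_derivative
          exp (- (\<i> * of_int k * of_real x))) (at (of_real x))"
        using False by (auto intro!: derivative_eq_intros)
      from has_vector_derivative_real_field[OF this, of "{-pi..pi}"]
      show ?thesis by (simp add: F_def[abs_def] cis_conv_exp mult_ac)
    qed
    show "continuous_on {-pi..pi} (\<lambda>t. cis (- (of_int k * t)))"
      unfolding cis_conv_exp by (intro continuous_intros)
  qed simp
  moreover have "F pi - F (- pi) = 0"
    using sin_npi_int[of k] by (simp add: F_def complex_eq_iff mult.commute)
  ultimately show ?thesis using False by simp
qed

text \<open>The character and the indicator of the cube both factor over the coordinates. If n is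
  nonzero, some one-dimensional factor integrates over full periods to 0.\<close>

lemma integral_character:
  fixes n :: "int ^ 'd"
  shows "(\<integral>\<theta>. character n \<theta> \<partial>torus) = (if n = 0 then complex_of_real ((2 * pi) ^ CARD('d)) else 0)"
proof -
  define f where "f j t = indicator {-pi..pi} t *\<^sub>R cis (- (of_int (n $ j) * t))" for j t
  have f: "integrable lborel (f j)" "integral\<^sup>L lborel (f j) = (if n $ j = 0 then complex_of_real (2 * pi) else 0)" for j
    using has_bochner_integral_cis_multiple[of "n $ j"]
    by (simp_all add: f_def[abs_def] has_bochner_integral_iff)
  have "indicator (cbox (\<chi> j. - pi) (\<chi> j. pi)) \<theta> *\<^sub>R character n \<theta> = (\<Prod>j\<in>UNIV. f j (\<theta> $ j))" for \<theta>
  proof -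
    have "cis (\<Sum>j\<in>A. x j) = (\<Prod>j\<in>A. cis (x j))" if "finite A" for x and A :: "'d set"
      using that by induction (simp_all add: cis_mult[symmetric])
    then have "character n \<theta> = (\<Prod>j\<in>UNIV. cis (- (of_int (n $ j) * \<theta> $ j)))"
      by (simp add: character_def sum_negf[symmetric])
    moreover have "indicator (cbox (\<chi> j. - pi) (\<chi> j. pi)) \<theta> = (\<Prod>j\<in>UNIV. indicator {-pi..pi} (\<theta> $ j) :: real)"
      by (auto simp: indicator_def mem_box_cart prod_zero_iff)
    ultimately show ?thesis
      by (simp add: f_def scaleR_conv_of_real prod.distrib)
  qed
  then have "(\<integral>\<theta>. character n \<theta> \<partial>torus) = (\<integral>\<theta>. (\<Prod>j\<in>UNIV. f j (\<theta> $ j)) \<partial>lborel)"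
    unfolding torus_def by (subst integral_restrict_space) auto
  also have "\<dots> = (\<Prod>j\<in>UNIV. if n $ j = 0 then complex_of_real (2 * pi) else 0)"
    by (simp add: integral_lborel_prod_cart f)
  also have "\<dots> = (if n = 0 then complex_of_real ((2 * pi) ^ CARD('d)) else 0)"
    by (auto simp: vec_eq_iff)
  finally show ?thesis .
qed

lemma inner2_character:
  fixes n m :: "int ^ 'd"
  shows "inner2 torus (character n) (character m) =
    (if n = m then complex_of_real ((2 * pi) ^ CARD('d)) else 0)"
  by (simp add: inner2_def cnj_character character_mult integral_character)

lemma fourier_sum_L2: "fourier_sum f A \<in> L2 torus"
proof -
  have "continuous_on UNIV (fourier_sum f A)"
    unfolding fourier_sum_def cis_conv_exp by (intro continuous_intros)
  from L2_torus_continuous[OF this] show ?thesis by (simp add: L2_torus_eq_L2)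
qed

lemma fourier_sum_add:
    "fourier_sum (\<lambda>n. f n + g n) A \<theta> = fourier_sum f A \<theta> + fourier_sum g A (\<theta> :: real ^ 'd)"
  and fourier_sum_diff: "fourier_sum (\<lambda>n. f n - g n) A \<theta> = fourier_sum f A \<theta> - fourier_sum g A \<theta>"
  and fourier_sum_cmult: "fourier_sum (\<lambda>n. c * f n) A \<theta> = c * fourier_sum f A \<theta>"
proof -
  define \<kappa> where "\<kappa> = complex_of_real (1 / sqrt ((2 * pi) ^ CARD('d)))"
  have *: "fourier_sum h A \<theta> = \<kappa> * (\<Sum>n\<in>A. h n * character n \<theta>)" for h
    by (simp only: \<kappa>_def fourier_sum_eq_characters)
  show "fourier_sum (\<lambda>n. f n + g n) A \<theta> = fourier_sum f A \<theta> + fourier_sum g A \<theta>"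
    by (simp add: * distrib_left distrib_right sum.distrib)
  show "fourier_sum (\<lambda>n. f n - g n) A \<theta> = fourier_sum f A \<theta> - fourier_sum g A \<theta>"
    by (simp add: * left_diff_distrib right_diff_distrib sum_subtractf)
  show "fourier_sum (\<lambda>n. c * f n) A \<theta> = c * fourier_sum f A \<theta>"
    by (simp add: * sum_distrib_left mult_ac)
qed

section \<open>Fourier coefficients and Bessel's inequality\<close>

definition fourier_coeff :: "(real ^ 'd \<Rightarrow> complex) \<Rightarrow> int ^ 'd \<Rightarrow> complex" where
  "fourier_coeff F n = complex_of_real (1 / sqrt ((2 * pi) ^ CARD('d))) * inner2 torus F (character n)"

lemma inner2_fourier_sum:
  assumes "F \<in> L2 torus"
  shows "inner2 torus F (fourier_sum g A) = (\<Sum>n\<in>A. fourier_coeff F n * cnj (g n))"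
proof -
  define \<kappa> where "\<kappa> = 1 / sqrt ((2 * pi) ^ CARD('a))"
  have "inner2 torus F (fourier_sum g A) =
      (\<integral>\<theta>. (\<Sum>n\<in>A. \<kappa> * cnj (g n) * (F \<theta> * cnj (character n \<theta>))) \<partial>torus)"
    unfolding inner2_def fourier_sum_eq_characters \<kappa>_def[symmetric]
    by (rule Bochner_Integration.integral_cong) (simp_all add: sum_distrib_left mult_ac)
  also have "\<dots> = (\<Sum>n\<in>A. \<kappa> * cnj (g n) * inner2 torus F (character n))"
    using assms by (subst Bochner_Integration.integral_sum) (auto simp: integrable_inner2 character_L2 inner2_def)
  also have "\<dots> = (\<Sum>n\<in>A. fourier_coeff F n * cnj (g n))"
    unfolding fourier_coeff_def \<kappa>_def[symmetric] by (simp add: mult_ac)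
  finally show ?thesis .
qed

lemma fourier_coeff_fourier_sum:
  assumes "finite A"
  shows "fourier_coeff (fourier_sum f A) n = (if n \<in> A then f n else 0)"
proof -
  define \<kappa> where "\<kappa> = 1 / sqrt ((2 * pi) ^ CARD('a))"
  \<comment> \<open>One factor \<open>\<kappa>\<close> comes from the coefficient, one from the sum;
    together they cancel the squared norm of a character.\<close>
  have \<kappa>: "complex_of_real \<kappa> * complex_of_real \<kappa> * complex_of_real ((2 * pi) ^ CARD('a)) = 1"
    unfolding of_real_mult[symmetric] by (simp add: \<kappa>_def)
  have "inner2 torus (fourier_sum f A) (character n) =
      (\<integral>\<theta>. (\<Sum>m\<in>A. \<kappa> * f m * (character m \<theta> * cnj (character n \<theta>))) \<partial>torus)"
    unfolding inner2_def fourier_sum_eq_characters \<kappa>_def[symmetric]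
    by (rule Bochner_Integration.integral_cong)
      (simp_all add: sum_distrib_left sum_distrib_right mult_ac)
  also have "\<dots> = (\<Sum>m\<in>A. \<kappa> * f m * inner2 torus (character m) (character n))"
    by (subst Bochner_Integration.integral_sum) (auto simp: integrable_inner2 character_L2 inner2_def)
  also have "\<dots> = (\<Sum>m\<in>A. if m = n then \<kappa> * f m * complex_of_real ((2 * pi) ^ CARD('a)) else 0)"
    unfolding inner2_character by (intro sum.cong) auto
  also have "\<dots> = (if n \<in> A then \<kappa> * f n * complex_of_real ((2 * pi) ^ CARD('a)) else 0)"
    using assms by simp
  finally show ?thesis
    unfolding fourier_coeff_def \<kappa>_def[symmetric] using \<kappa> by (auto simp: mult_ac)
qed

lemma inner2_fourier_sums:
  assumes "finite A"
  shows "inner2 torus (fourier_sum f A) (fourier_sum g A) = (\<Sum>n\<in>A. f n * cnj (g n))"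
  using assms by (simp add: inner2_fourier_sum fourier_sum_L2 fourier_coeff_fourier_sum)

text \<open>Pythagoras: \<open>F\<close> minus its partial Fourier sum over \<open>A\<close> is
  orthogonal to every Fourier sum over \<open>A\<close>. Taking g = 0 gives Bessel's inequality;
  general g shows that the partial sum is the best approximation with frequencies in
  \<open>A\<close>.\<close>

lemma norm2_diff_fourier_sum:
  assumes F: "F \<in> L2 torus" and A: "finite A"
  shows "(norm2 torus (\<lambda>\<theta>. F \<theta> - fourier_sum g A \<theta>))\<^sup>2 =
    (norm2 torus (\<lambda>\<theta>. F \<theta> - fourier_sum (fourier_coeff F) A \<theta>))\<^sup>2 +
    (norm2 torus (fourier_sum (\<lambda>n. fourier_coeff F n - g n) A))\<^sup>2"
proof -
  let ?S = "fourier_sum (fourier_coeff F) A" and ?Q = "fourier_sum (\<lambda>n. fourier_coeff F n - g n) A"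
  have "inner2 torus (\<lambda>\<theta>. F \<theta> - ?S \<theta>) ?Q = 0"
    using assms by (simp add: inner2_diff_left fourier_sum_L2 inner2_fourier_sum fourier_coeff_fourier_sum)
  then show ?thesis
    using norm2_add_square[OF L2_diff[OF F fourier_sum_L2[of "fourier_coeff F" A]] fourier_sum_L2[of "\<lambda>n. fourier_coeff F n - g n" A]]
    by (simp add: fourier_sum_diff)
qed

lemma fourier_coeff_ell2:
  assumes F: "F \<in> L2 torus"
  shows "fourier_coeff F \<in> ell2"
proof -
  have "(\<Sum>n\<in>A. (cmod (fourier_coeff F n))\<^sup>2) \<le> (norm2 torus F)\<^sup>2" if "finite A" for A
  proof -
    have "complex_of_real (\<Sum>n\<in>A. (cmod (fourier_coeff F n))\<^sup>2) =
        complex_of_real ((norm2 torus (fourier_sum (fourier_coeff F) A))\<^sup>2)"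
      unfolding inner2_self[symmetric] inner2_fourier_sums[OF that] of_real_sum complex_norm_square ..
    then have "(\<Sum>n\<in>A. (cmod (fourier_coeff F n))\<^sup>2) = (norm2 torus (fourier_sum (fourier_coeff F) A))\<^sup>2"
      using of_real_eq_iff by blast
    also have "\<dots> \<le> (norm2 torus F)\<^sup>2"
      using norm2_diff_fourier_sum[OF F that, of "\<lambda>_. 0"] by (simp add: fourier_sum_def[of "\<lambda>_. 0"])
    finally show ?thesis .
  qed
  then show ?thesis
    unfolding ell2_def mem_Collect_eq
    by (intro nonneg_bdd_above_summable_on bdd_aboveI[of _ "(norm2 torus F)\<^sup>2"]) auto
qed

section \<open>The Fourier transform as a linear isometry\<close>

lemma has_fourier_iff:
  "has_fourier f F \<longleftrightarrow> F \<in> L2 torus \<and>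
    ((\<lambda>A. norm2 torus (\<lambda>\<theta>. F \<theta> - fourier_sum f A \<theta>)) \<longlongrightarrow> 0) (finite_subsets_at_top UNIV)"
  unfolding has_fourier_def L2_torus_eq_L2 norm2_square[symmetric]
proof -
  have "((\<lambda>A. (X A)\<^sup>2) \<longlongrightarrow> 0) Z \<longleftrightarrow> (X \<longlongrightarrow> 0) Z" if "\<And>A. X A \<ge> 0"
    for X :: "_ \<Rightarrow> real" and Z
    using tendsto_power[of X 0 Z 2] tendsto_real_sqrt[of "\<lambda>A. (X A)\<^sup>2" 0 Z] that by auto
  then show "(F \<in> L2 torus \<and> ((\<lambda>A. (norm2 torus (\<lambda>\<theta>. F \<theta> - fourier_sum f A \<theta>))\<^sup>2) \<longlongrightarrow> 0)
      (finite_subsets_at_top UNIV)) \<longleftrightarrow> F \<in> L2 torus \<and>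
    ((\<lambda>A. norm2 torus (\<lambda>\<theta>. F \<theta> - fourier_sum f A \<theta>)) \<longlongrightarrow> 0) (finite_subsets_at_top UNIV)"
    by (simp add: norm2_nonneg)
qed

lemma has_fourier_add:
  assumes "has_fourier f F" "has_fourier g G"
  shows "has_fourier (\<lambda>n. f n + g n) (\<lambda>\<theta>. F \<theta> + G \<theta>)"
proof -
  have L: "F \<in> L2 torus" "G \<in> L2 torus" using assms by (auto simp: has_fourier_iff)
  have "((\<lambda>A. norm2 torus (\<lambda>\<theta>. F \<theta> + G \<theta> - fourier_sum (\<lambda>n. f n + g n) A \<theta>)) \<longlongrightarrow> 0)
      (finite_subsets_at_top UNIV)"
  proof (rule tendsto_sandwich[OF _ _ tendsto_const])
    show "((\<lambda>A. norm2 torus (\<lambda>\<theta>. F \<theta> - fourier_sum f A \<theta>) + norm2 torus (\<lambda>\<theta>. G \<theta> - fourier_sum g A \<theta>))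
        \<longlongrightarrow> 0) (finite_subsets_at_top UNIV)"
      using assms by (auto simp: has_fourier_iff intro: tendsto_add_zero)
    have "norm2 torus (\<lambda>\<theta>. F \<theta> + G \<theta> - fourier_sum (\<lambda>n. f n + g n) A \<theta>) \<le>
        norm2 torus (\<lambda>\<theta>. F \<theta> - fourier_sum f A \<theta>) + norm2 torus (\<lambda>\<theta>. G \<theta> - fourier_sum g A \<theta>)" for A
      using norm2_triangle[OF L2_diff[OF L(1) fourier_sum_L2] L2_diff[OF L(2) fourier_sum_L2], of f A g A]
      by (simp add: fourier_sum_add algebra_simps)
    then show "\<forall>\<^sub>F A in finite_subsets_at_top UNIV.
      norm2 torus (\<lambda>\<theta>. F \<theta> + G \<theta> - fourier_sum (\<lambda>n. f n + g n) A \<theta>) \<le>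
      norm2 torus (\<lambda>\<theta>. F \<theta> - fourier_sum f A \<theta>) + norm2 torus (\<lambda>\<theta>. G \<theta> - fourier_sum g A \<theta>)"
      by simp
  qed (simp add: norm2_nonneg)
  with L show ?thesis by (simp add: has_fourier_iff L2_add)
qed

lemma has_fourier_cmult:
  assumes "has_fourier f F"
  shows "has_fourier (\<lambda>n. c * f n) (\<lambda>\<theta>. c * F \<theta>)"
proof -
  have "((\<lambda>A. cmod c * norm2 torus (\<lambda>\<theta>. F \<theta> - fourier_sum f A \<theta>)) \<longlongrightarrow> 0) (finite_subsets_at_top UNIV)"
    using assms by (auto simp: has_fourier_iff intro: tendsto_mult_right_zero)
  then show ?thesis
    using assms norm2_cmult[of torus c "\<lambda>\<theta>. F \<theta> - fourier_sum f A \<theta>" for A, symmetric]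
    by (simp add: has_fourier_iff L2_cmult fourier_sum_cmult right_diff_distrib)
qed

lemma has_fourier_diff:
  assumes "has_fourier f F" "has_fourier g G"
  shows "has_fourier (\<lambda>n. f n - g n) (\<lambda>\<theta>. F \<theta> - G \<theta>)"
  using has_fourier_add[OF assms(1) has_fourier_cmult[OF assms(2), of "-1"]] by simp

text \<open>Parseval's identity. With partial sums S of \<open>f\<close> and T of \<open>g\<close>,
  orthogonality makes the finite sum equal to <S, T>. Its distance to <F, G> is controlled through
  <F - S, G> + <S, G - T>.\<close>

lemma has_fourier_inner2:
  assumes f: "has_fourier f F" and g: "has_fourier g G"
  shows "((\<lambda>n. f n * cnj (g n)) has_sum inner2 torus F G) UNIV"
proof -
  have L: "F \<in> L2 torus" "G \<in> L2 torus" using assms by (auto simp: has_fourier_iff)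
  let ?d = "\<lambda>f F A. norm2 torus (\<lambda>\<theta>. F \<theta> - fourier_sum f A \<theta>)"
  have lim: "(?d f F \<longlongrightarrow> 0) (finite_subsets_at_top UNIV)" "(?d g G \<longlongrightarrow> 0) (finite_subsets_at_top UNIV)"
    using assms by (auto simp: has_fourier_iff)
  have "((\<lambda>A. ?d f F A * norm2 torus G + (norm2 torus F + ?d f F A) * ?d g G A)
      \<longlongrightarrow> 0 * norm2 torus G + (norm2 torus F + 0) * 0) (finite_subsets_at_top UNIV)"
    by (intro tendsto_intros lim)
  then have "((\<lambda>A. ?d f F A * norm2 torus G + (norm2 torus F + ?d f F A) * ?d g G A)
      \<longlongrightarrow> 0) (finite_subsets_at_top UNIV)" by simp
  moreover have "\<forall>\<^sub>F A in finite_subsets_at_top UNIV. norm ((\<Sum>n\<in>A. f n * cnj (g n)) - inner2 torus F G) \<le>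
      ?d f F A * norm2 torus G + (norm2 torus F + ?d f F A) * ?d g G A"
  proof (rule eventually_finite_subsets_at_top_weakI)
    fix A :: "(int ^ 'a) set" assume A: "finite A"
    let ?S = "fourier_sum f A" and ?T = "fourier_sum g A"
    have "inner2 torus F G - (\<Sum>n\<in>A. f n * cnj (g n)) =
        inner2 torus (\<lambda>\<theta>. F \<theta> - ?S \<theta>) G + inner2 torus ?S (\<lambda>\<theta>. G \<theta> - ?T \<theta>)"
      using L A by (simp add: inner2_diff_left inner2_diff_right fourier_sum_L2 inner2_fourier_sums)
    also have "cmod \<dots> \<le> cmod (inner2 torus (\<lambda>\<theta>. F \<theta> - ?S \<theta>) G) + cmod (inner2 torus ?S (\<lambda>\<theta>. G \<theta> - ?T \<theta>))"
      by (rule norm_triangle_ineq)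
    also have "\<dots> \<le> ?d f F A * norm2 torus G + norm2 torus ?S * ?d g G A"
      using L by (intro add_mono Cauchy_Schwarz_inner2 L2_diff fourier_sum_L2)
    also have "\<dots> \<le> ?d f F A * norm2 torus G + (norm2 torus F + ?d f F A) * ?d g G A"
    proof -
      have "norm2 torus ?S \<le> norm2 torus F + norm2 torus (\<lambda>\<theta>. ?S \<theta> - F \<theta>)"
        using norm2_triangle[OF L(1) L2_diff[OF fourier_sum_L2[of f A] L(1)]] by simp
      then show ?thesis
        by (intro add_left_mono mult_right_mono norm2_nonneg) (subst norm2_minus_commute)
    qed
    finally show "norm ((\<Sum>n\<in>A. f n * cnj (g n)) - inner2 torus F G) \<le>
      ?d f F A * norm2 torus G + (norm2 torus F + ?d f F A) * ?d g G A"
      by (subst norm_minus_commute)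
  qed
  ultimately have "((\<lambda>A. (\<Sum>n\<in>A. f n * cnj (g n)) - inner2 torus F G) \<longlongrightarrow> 0) (finite_subsets_at_top UNIV)"
    by (rule Lim_null_comparison[rotated])
  then show ?thesis unfolding has_sum_def by (rule LIM_zero_cancel)
qed

lemma ell2_inner_has_fourier: "has_fourier f F \<Longrightarrow> has_fourier g G \<Longrightarrow> ell2_inner f g = inner2 torus F G"
  unfolding ell2_inner_def by (intro infsumI has_fourier_inner2)

lemma ell2_norm_has_fourier:
  assumes "has_fourier f F" "f \<in> ell2"
  shows "ell2_norm f = norm2 torus F"
proof -
  have "complex_of_real ((ell2_norm f)\<^sup>2) = complex_of_real ((norm2 torus F)\<^sup>2)"
    using ell2_inner_has_fourier[OF assms(1,1)] assms(2) by (simp add: ell2_inner_self inner2_self)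
  then have "(ell2_norm f)\<^sup>2 = (norm2 torus F)\<^sup>2" using of_real_eq_iff by blast
  then show ?thesis using ell2_norm_nonneg[OF assms(2)] norm2_nonneg by (rule power2_eq_imp_eq)
qed


section \<open>Density of trigonometric polynomials\<close>

text \<open>Closure under products is needed for Stone-Weierstrass and for multiplying by \<psi>. In
  the inductive form it is a double induction instead of a convolution of coefficients.\<close>

inductive trig_poly :: "(real ^ 'd \<Rightarrow> complex) \<Rightarrow> bool" where
  monom: "trig_poly (\<lambda>\<theta>. c * character n \<theta>)"
| add: "trig_poly P \<Longrightarrow> trig_poly Q \<Longrightarrow> trig_poly (\<lambda>\<theta>. P \<theta> + Q \<theta>)"

lemma trig_poly_const: "trig_poly (\<lambda>_. c)"
  using trig_poly.monom[of c 0] by (simp add: character_def)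

lemma trig_poly_mult:
  assumes "trig_poly P" "trig_poly Q"
  shows "trig_poly (\<lambda>\<theta>. P \<theta> * Q \<theta>)"
  using assms(1)
proof induction
  case (monom c n)
  show ?case using assms(2)
  proof induction
    case (monom d m)
    have "(\<lambda>\<theta>. c * character n \<theta> * (d * character m \<theta>)) = (\<lambda>\<theta>. c * d * character (n + m) \<theta>)"
      by (simp add: character_mult[symmetric] mult_ac)
    then show ?case using trig_poly.monom by metis
  next
    case (add P Q)
    then show ?case using trig_poly.add by (simp add: distrib_left)
  qed
next
  case (add P Q)
  then show ?case using trig_poly.add by (simp add: distrib_right)
qed

lemma trig_poly_diff: "trig_poly P \<Longrightarrow> trig_poly Q \<Longrightarrow> trig_poly (\<lambda>\<theta>. P \<theta> - Q \<theta>)"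
  using trig_poly.add[OF _ trig_poly_mult[OF trig_poly_const[of "-1"]], of P Q] by simp

lemma trig_poly_power: "trig_poly P \<Longrightarrow> trig_poly (\<lambda>\<theta>. P \<theta> ^ k)"
  by (induction k) (auto intro: trig_poly_const[of 1] trig_poly_mult)

lemma trig_poly_prod:
  assumes "\<And>i. i \<in> I \<Longrightarrow> trig_poly (P i)"
  shows "trig_poly (\<lambda>\<theta>. \<Prod>i\<in>I. P i \<theta>)"
  using assms by (induction I rule: infinite_finite_induct) (auto intro: trig_poly_const[of 1] trig_poly_mult)

lemma trig_poly_cis: "trig_poly (\<lambda>\<theta>. cis (\<theta> $ j))" "trig_poly (\<lambda>\<theta>. cis (- \<theta> $ j))"
proof -
  have *: "(\<Sum>i\<in>UNIV. of_int (axis j c $ i) * \<theta> $ i) = of_int c * (\<theta> $ j :: real)" for c \<theta>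
  proof -
    have "(\<Sum>i\<in>UNIV. of_int (axis j c $ i) * \<theta> $ i) = (\<Sum>i\<in>UNIV. if i = j then of_int c * \<theta> $ j else 0)"
      by (rule sum.cong) (auto simp: axis_def)
    then show ?thesis by simp
  qed
  show "trig_poly (\<lambda>\<theta>. cis (\<theta> $ j))" "trig_poly (\<lambda>\<theta>. cis (- \<theta> $ j))"
    \<comment> \<open>The exponent in \<open>character\<close> carries a minus sign, so the
      frequency of \<open>cis (\<theta> $ j)\<close> is \<open>axis j (-1)\<close>.\<close>
    using trig_poly.monom[of 1 "axis j (-1)"] trig_poly.monom[of 1 "axis j 1"]
    unfolding character_def * by simp_all
qed

lemma trig_poly_cos: "trig_poly (\<lambda>\<theta>. complex_of_real (cos (\<theta> $ j)))"
proof -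
  have "(\<lambda>\<theta>. complex_of_real (cos (\<theta> $ j))) = (\<lambda>\<theta>. 1 / 2 * (cis (\<theta> $ j) + cis (- \<theta> $ j)))"
    by (simp add: complex_eq_iff fun_eq_iff)
  then show ?thesis by (simp only:) (intro trig_poly_mult trig_poly_const trig_poly.add trig_poly_cis)
qed

lemma trig_poly_sin: "trig_poly (\<lambda>\<theta>. complex_of_real (sin (\<theta> $ j)))"
proof -
  have "(\<lambda>\<theta>. complex_of_real (sin (\<theta> $ j))) = (\<lambda>\<theta>. - \<i> / 2 * (cis (\<theta> $ j) - cis (- \<theta> $ j)))"
    by (simp add: complex_eq_iff fun_eq_iff)
  then show ?thesis by (simp only:) (intro trig_poly_mult trig_poly_const trig_poly_diff trig_poly_cis)
qed

text \<open>Allowing every finite \<open>A\<close> that contains the support lets the addition step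
  expand both summands over a common set, while the support of the sum may shrink by
  cancellation.\<close>

lemma trig_poly_fourier_sum:
  assumes "trig_poly P"
  shows "\<exists>f\<in>ell2_c. \<forall>A. finite A \<longrightarrow> {n. f n \<noteq> 0} \<subseteq> A \<longrightarrow> P = fourier_sum f A"
  using assms
proof induction
  case (monom c n)
  define f where "f m = (if m = n then c * sqrt ((2 * pi) ^ CARD('a)) else 0)" for m
  have f: "{m. f m \<noteq> 0} \<subseteq> {n}" by (auto simp: f_def)
  then have "f \<in> ell2_c" by (auto simp: ell2_c_def intro: finite_subset)
  moreover have "(\<lambda>\<theta>. c * character n \<theta>) = fourier_sum f A"
    if "finite A" "{m. f m \<noteq> 0} \<subseteq> A" for A
  proof
    fix \<theta> :: "real ^ 'a"
    have "(\<Sum>m\<in>A. f m * character m \<theta>) = (\<Sum>m\<in>{n} \<inter> A. f m * character m \<theta>)"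
      by (rule sum.mono_neutral_right) (use that f in auto)
    also have "\<dots> = (\<Sum>m\<in>{n}. f m * character m \<theta>)"
      by (rule sum.mono_neutral_left) (use that in auto)
    finally show "c * character n \<theta> = fourier_sum f A \<theta>"
      by (simp add: fourier_sum_eq_characters f_def)
  qed
  ultimately show ?case by blast
next
  case (add P Q)
  then obtain f g where f: "f \<in> ell2_c" "\<And>A. finite A \<Longrightarrow> {n. f n \<noteq> 0} \<subseteq> A \<Longrightarrow> P = fourier_sum f A"
    and g: "g \<in> ell2_c" "\<And>A. finite A \<Longrightarrow> {n. g n \<noteq> 0} \<subseteq> A \<Longrightarrow> Q = fourier_sum g A"
    by blast
  let ?h = "\<lambda>n. f n + g n" and ?B = "{n. f n \<noteq> 0} \<union> {n. g n \<noteq> 0}"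
  have B: "finite ?B" "{n. ?h n \<noteq> 0} \<subseteq> ?B" using f(1) g(1) by (auto simp: ell2_c_def)
  then have "?h \<in> ell2_c" unfolding ell2_c_def using finite_subset by blast
  moreover have "(\<lambda>\<theta>. P \<theta> + Q \<theta>) = fourier_sum ?h A" if A: "finite A" "{n. ?h n \<noteq> 0} \<subseteq> A" for A
  proof
    fix \<theta> :: "real ^ 'a"
    have fin: "finite (A \<union> ?B)" using A B by simp
    have "P = fourier_sum f (A \<union> ?B)" "Q = fourier_sum g (A \<union> ?B)"
      by (rule f(2)[OF fin] g(2)[OF fin], blast)+
    then have "P \<theta> + Q \<theta> = fourier_sum ?h (A \<union> ?B) \<theta>" by (simp only: fourier_sum_add)
    also have "\<dots> = fourier_sum ?h A \<theta>"
      by (rule fourier_sum_mono) (use fin A in auto)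
    finally show "P \<theta> + Q \<theta> = fourier_sum ?h A \<theta>" .
  qed
  ultimately show ?case by (intro bexI[of _ ?h] allI impI)
qed

lemma trig_poly_L2: "trig_poly P \<Longrightarrow> P \<in> L2 torus"
  by (induction rule: trig_poly.induct) (auto intro: L2_add L2_cmult character_L2)

section \<open>Approximation on the cube, first uniform and then in mean square\<close>

abbreviation torus_cube :: "(real ^ 'd) set" where
  "torus_cube \<equiv> cbox (\<chi> j. - pi) (\<chi> j. pi)"

abbreviation torus_box :: "(real ^ 'd) set" where
  "torus_box \<equiv> box (\<chi> j. - pi) (\<chi> j. pi)"

lemma space_torus: "space torus = torus_cube"
  by (simp add: torus_def space_restrict_space)

lemma AE_torusI: "AE \<theta> in lborel. P \<theta> \<Longrightarrow> AE \<theta> in torus. P \<theta>"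
  unfolding torus_def by (subst AE_restrict_space_iff) auto

lemma AE_torus_not_in_negligible: "negligible N \<Longrightarrow> AE \<theta> in torus. \<theta> \<notin> N"
  by (intro AE_torusI) (metis AE_completion_iff AE_not_in negligible_iff_null_sets)

lemma AE_torus_box: "AE \<theta> in torus. \<theta> \<in> torus_box"
  using AE_torus_not_in_negligible[OF negligible_frontier_interval[of "\<chi> j. - pi" "\<chi> j. pi"]] AE_space
  by eventually_elim (simp add: space_torus)

text \<open>
  A function on the cube that vanishes on the boundary factors through the torus, realised as a
  compact subset of \<open>complex ^ 'd\<close>, where the trigonometric polynomials separate points.
\<close>

lemma trig_poly_uniform_approx_real:
  fixes g :: "real ^ 'd \<Rightarrow> real"
  assumes cont: "continuous_on torus_cube g" and bd: "\<And>\<theta>. \<theta> \<in> torus_cube - torus_box \<Longrightarrow> g \<theta> = 0"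
    and e: "e > 0"
  obtains Q where "trig_poly Q" "\<And>\<theta>. \<theta> \<in> torus_cube \<Longrightarrow> cmod (complex_of_real (g \<theta>) - Q \<theta>) < e"
proof -
  define E where "E \<theta> = (\<chi> j. cis (\<theta> $ j))" for \<theta> :: "real ^ 'd"
  define K where "K = E ` torus_cube"
  have contE: "continuous_on A E" for A
    unfolding E_def cis_conv_exp by (intro continuous_intros)
  have K: "compact K" unfolding K_def by (intro compact_continuous_image contE compact_cbox)
  \<comment> \<open>\<open>Arg\<close> recovers the angles in the open box. On the boundary an angle
    -pi comes back as pi, so the recovered point may differ, but it is again a boundary point and
    \<open>g\<close> vanishes at both.\<close>
  define g' where "g' z = g (\<chi> j. Arg (z $ j))" for z
  have g': "g' (E \<theta>) = g \<theta>" if \<theta>: "\<theta> \<in> torus_cube" for \<theta>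
  proof (cases "\<theta> \<in> torus_box")
    case True
    then have "Arg (cis (\<theta> $ j)) = \<theta> $ j" for j
      by (intro Arg_cis) (auto simp: mem_box_cart less_imp_le)
    then show ?thesis by (simp add: g'_def E_def)
  next
    case False
    then obtain j where "\<not> (- pi < \<theta> $ j \<and> \<theta> $ j < pi)" by (auto simp: mem_box_cart)
    moreover have "- pi \<le> \<theta> $ j" "\<theta> $ j \<le> pi" using \<theta> by (auto simp: mem_box_cart)
    ultimately have "cis (\<theta> $ j) = -1" by (auto simp: complex_eq_iff not_less)
    then have "Arg (E \<theta> $ j) = pi" by (simp add: E_def Arg_eq_pi)
    then have "(\<chi> j. Arg (E \<theta> $ j)) \<notin> torus_box" by (auto simp: mem_box_cart intro!: exI[of _ j])
    moreover have "(\<chi> j. Arg (E \<theta> $ j)) \<in> torus_cube"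
      using mpi_less_Arg Arg_le_pi by (auto simp: mem_box_cart less_imp_le)
    ultimately have "g' (E \<theta>) = 0" by (simp add: g'_def bd)
    then show ?thesis using bd False \<theta> by simp
  qed
  \<comment> \<open>\<open>Arg\<close> is discontinuous along the negative axis, so continuity does
    not follow by composition. Instead, the preimage of a closed set under \<open>g'\<close> is the
    \<open>E\<close>-image of a compact set, hence closed.\<close>
  have contg': "continuous_on K g'"
    unfolding continuous_on_closed_invariant
  proof (intro allI impI exI conjI)
    fix B :: "real set" assume B: "closed B"
    have "compact (torus_cube \<inter> (torus_cube \<inter> g -` B))"
      by (intro compact_Int_closed compact_cbox continuous_closed_preimage[OF cont closed_cbox B])
    then have "compact (E ` (torus_cube \<inter> g -` B))"
      by (intro compact_continuous_image contE) simp
    then show "closed (E ` (torus_cube \<inter> g -` B))" by (rule compact_imp_closed)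
    show "E ` (torus_cube \<inter> g -` B) \<inter> K = g' -` B \<inter> K"
      using g' by (auto simp: K_def)
  qed
  \<comment> \<open>The algebra for Stone-Weierstrass: continuous functions on \<open>K\<close> that
    pull back along \<open>E\<close> to trigonometric polynomials.\<close>
  define P where "P \<phi> \<longleftrightarrow> continuous_on K \<phi> \<and> trig_poly (\<lambda>\<theta>. complex_of_real (\<phi> (E \<theta>)))" for \<phi>
  have "\<exists>\<phi>. P \<phi> \<and> (\<forall>z\<in>K. \<bar>g' z - \<phi> z\<bar> < e)"
  proof (rule Stone_Weierstrass_HOL[OF K])
    show "P (\<lambda>_. c)" for c by (simp add: P_def trig_poly_const)
    show "continuous_on K \<phi>" if "P \<phi>" for \<phi> using that by (simp add: P_def)
    show "P (\<lambda>x. \<phi> x + \<psi> x)" if "P \<phi> \<and> P \<psi>" for \<phi> \<psi>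
      using that by (auto simp: P_def intro: continuous_intros trig_poly.add)
    show "P (\<lambda>x. \<phi> x * \<psi> x)" if "P \<phi> \<and> P \<psi>" for \<phi> \<psi>
      using that by (auto simp: P_def intro: continuous_intros trig_poly_mult)
    show "\<exists>\<phi>. P \<phi> \<and> \<phi> x \<noteq> \<phi> y" if xy: "x \<in> K \<and> y \<in> K \<and> x \<noteq> y" for x y
    proof -
      obtain j where "x $ j \<noteq> y $ j" using xy by (auto simp: vec_eq_iff)
      then consider "Re (x $ j) \<noteq> Re (y $ j)" | "Im (x $ j) \<noteq> Im (y $ j)" by (auto simp: complex_eq_iff)
      moreover have "P (\<lambda>z. Re (z $ j))" "P (\<lambda>z. Im (z $ j))"
        by (auto simp: P_def E_def trig_poly_cos trig_poly_sin intro!: continuous_intros)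
      ultimately show ?thesis by metis
    qed
  qed (use contg' e in auto)
  then obtain \<phi> where \<phi>: "P \<phi>" "\<And>z. z \<in> K \<Longrightarrow> \<bar>g' z - \<phi> z\<bar> < e" by blast
  show ?thesis
  proof
    show "trig_poly (\<lambda>\<theta>. complex_of_real (\<phi> (E \<theta>)))" using \<phi>(1) by (simp add: P_def)
    fix \<theta> :: "real ^ 'd" assume "\<theta> \<in> torus_cube"
    then show "cmod (complex_of_real (g \<theta>) - complex_of_real (\<phi> (E \<theta>))) < e"
      using \<phi>(2)[of "E \<theta>"] g' by (simp add: K_def flip: of_real_diff)
  qed
qed

lemma trig_poly_uniform_approx:
  fixes g :: "real ^ 'd \<Rightarrow> complex"
  assumes cont: "continuous_on torus_cube g" and bd: "\<And>\<theta>. \<theta> \<in> torus_cube - torus_box \<Longrightarrow> g \<theta> = 0"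
    and e: "e > 0"
  obtains Q where "trig_poly Q" "\<And>\<theta>. \<theta> \<in> torus_cube \<Longrightarrow> cmod (g \<theta> - Q \<theta>) < e"
proof -
  have e2: "e / 2 > 0" using e by simp
  have Re: "continuous_on torus_cube (\<lambda>\<theta>. Re (g \<theta>))" and Im: "continuous_on torus_cube (\<lambda>\<theta>. Im (g \<theta>))"
    by (intro continuous_intros cont)+
  obtain Q where Q: "trig_poly Q" "\<And>\<theta>. \<theta> \<in> torus_cube \<Longrightarrow> cmod (complex_of_real (Re (g \<theta>)) - Q \<theta>) < e / 2"
    using trig_poly_uniform_approx_real[OF Re _ e2] by (auto simp: bd)
  obtain R where R: "trig_poly R" "\<And>\<theta>. \<theta> \<in> torus_cube \<Longrightarrow> cmod (complex_of_real (Im (g \<theta>)) - R \<theta>) < e / 2"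
    using trig_poly_uniform_approx_real[OF Im _ e2] by (auto simp: bd)
  show ?thesis
  proof
    show "trig_poly (\<lambda>\<theta>. Q \<theta> + \<i> * R \<theta>)"
      using Q R by (intro trig_poly.add trig_poly_mult trig_poly_const)
    fix \<theta> :: "real ^ 'd" assume \<theta>: "\<theta> \<in> torus_cube"
    have "(Re (g \<theta>) - Q \<theta>) + \<i> * (Im (g \<theta>) - R \<theta>) = (Re (g \<theta>) + \<i> * Im (g \<theta>)) - (Q \<theta> + \<i> * R \<theta>)"
      by (simp only: algebra_simps)
    then have "g \<theta> - (Q \<theta> + \<i> * R \<theta>) = (Re (g \<theta>) - Q \<theta>) + \<i> * (Im (g \<theta>) - R \<theta>)"
      by (simp only: complex_eq[symmetric])
    also have "cmod \<dots> \<le> cmod (Re (g \<theta>) - Q \<theta>) + cmod (\<i> * (Im (g \<theta>) - R \<theta>))"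
      by (rule norm_triangle_ineq)
    also have "\<dots> < e" using Q(2)[OF \<theta>] R(2)[OF \<theta>] by (simp add: norm_mult)
    finally show "cmod (g \<theta> - (Q \<theta> + \<i> * R \<theta>)) < e" .
  qed
qed

text \<open>A measurable function is an almost everywhere limit of continuous \<open>g n\<close>.
  The factor \<open>cut n\<close> forces the value 0 outside the open box, as the uniform
  approximation demands, and tends to 1 inside; the factor
  \<open>B / max B (cmod (g n \<theta>))\<close> clips the modulus at \<open>B\<close> and also
  tends to 1, as the limit is bounded by \<open>B\<close>.\<close>

lemma continuous_AE_approx:
  fixes F :: "real ^ 'd \<Rightarrow> complex"
  assumes F: "F \<in> borel_measurable torus" and bound: "\<And>\<theta>. cmod (F \<theta>) \<le> B"
  obtains h :: "nat \<Rightarrow> real ^ 'd \<Rightarrow> complex"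
  where "\<And>n. continuous_on UNIV (h n)" "\<And>n \<theta>. \<theta> \<notin> torus_box \<Longrightarrow> h n \<theta> = 0"
    "\<And>n \<theta>. cmod (h n \<theta>) \<le> B" "AE \<theta> in torus. (\<lambda>n. h n \<theta>) \<longlonglongrightarrow> F \<theta>"
proof -
  have B: "B \<ge> 0" using bound[of undefined] norm_ge_zero order_trans by blast
  define F0 where "F0 \<theta> = indicator torus_cube \<theta> *\<^sub>R F \<theta>" for \<theta>
  have "F0 \<in> borel_measurable lborel"
    using F unfolding torus_def F0_def
    by (subst (asm) borel_measurable_restrict_space_iff) (simp_all add: mult.commute)
  then have "F0 \<in> borel_measurable lebesgue" by (rule measurable_completion)
  then have "F0 measurable_on UNIV" by (intro lebesgue_measurable_imp_measurable_on) auto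
  then obtain N g where N: "negligible N" "\<And>n. continuous_on UNIV (g n)"
      "\<And>\<theta>. \<theta> \<notin> N \<Longrightarrow> (\<lambda>n. g n \<theta>) \<longlonglongrightarrow> F0 \<theta>"
    unfolding measurable_on_def by auto
  define cut where "cut n \<theta> = min 1 (real n * infdist \<theta> (- torus_box))" for n and \<theta> :: "real ^ 'd"
  define h where "h n \<theta> = (cut n \<theta> * (B / max B (cmod (g n \<theta>)))) *\<^sub>R g n \<theta>" for n \<theta>
  have cut: "0 \<le> cut n \<theta>" "cut n \<theta> \<le> 1" for n \<theta> by (auto simp: cut_def infdist_nonneg)
  show ?thesis
  \<comment> \<open>Split off to keep the denominator \<open>max B (cmod (g n \<theta>))\<close>
    positive.\<close>
  proof (cases "B = 0")
    case True
    then have "F = (\<lambda>_. 0)" using bound by (auto simp: fun_eq_iff)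
    then show ?thesis using that[of "\<lambda>_ _. 0"] B by simp
  next
    case False
    with B have B: "B > 0" by simp
    then have mx: "max B t \<noteq> 0" "max B t > 0" for t by auto
    show ?thesis
    proof
      show "continuous_on UNIV (h n)" for n
        unfolding h_def cut_def using mx by (intro continuous_intros N) auto
      show "h n \<theta> = 0" if "\<theta> \<notin> torus_box" for n \<theta>
        using that by (simp add: h_def cut_def)
      show "cmod (h n \<theta>) \<le> B" for n \<theta>
      proof -
        have "cmod (h n \<theta>) = cut n \<theta> * (B * (cmod (g n \<theta>) / max B (cmod (g n \<theta>))))"
          using cut B mx by (simp add: h_def abs_mult)
        also have "\<dots> \<le> 1 * (B * 1)"
          using cut B mx by (intro mult_mono) (auto simp: divide_le_eq_1)
        finally show ?thesis by simp
      qed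
      show "AE \<theta> in torus. (\<lambda>n. h n \<theta>) \<longlonglongrightarrow> F \<theta>"
        using AE_torus_box AE_torus_not_in_negligible[OF N(1)]
      proof eventually_elim
        case (elim \<theta>)
        then have "\<theta> \<in> torus_cube" using box_subset_cbox by blast
        then have "F0 \<theta> = F \<theta>" by (simp add: F0_def)
        then have g: "(\<lambda>n. g n \<theta>) \<longlonglongrightarrow> F \<theta>" using N(3) elim by metis
        have ne: "- torus_box \<noteq> ({} :: (real ^ 'd) set)"
          using bounded_box not_bounded_UNIV by (metis Compl_eq_Diff_UNIV Diff_eq_empty_iff UNIV_I bounded_subset)
        have pos: "infdist \<theta> (- torus_box) > 0"
          by (rule infdist_pos_not_in_closed) (use elim ne in auto)
        have "\<forall>\<^sub>F n in sequentially. 1 / infdist \<theta> (- torus_box) \<le> real n"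
          using filterlim_real_sequentially unfolding filterlim_at_top by blast
        then have "\<forall>\<^sub>F n in sequentially. cut n \<theta> = 1"
          by eventually_elim (use pos in \<open>simp add: cut_def field_simps\<close>)
        then have "(\<lambda>n. cut n \<theta>) \<longlonglongrightarrow> 1" by (rule tendsto_eventually)
        then have "(\<lambda>n. h n \<theta>) \<longlonglongrightarrow> (1 * (B / max B (cmod (F \<theta>)))) *\<^sub>R F \<theta>"
          unfolding h_def by (intro tendsto_intros g mx)
        moreover have "max B (cmod (F \<theta>)) = B" using bound by (simp add: max_absorb1)
        ultimately show ?case using B by simp
      qed
    qed
  qed
qed

text \<open>Dominated convergence passes from \<open>F\<close> to a continuous function that
  vanishes on the boundary. Uniform approximation of the latter is mean square approximation because
  the torus has finite measure.\<close>

lemma trig_poly_dense_bounded: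
  fixes F :: "real ^ 'd \<Rightarrow> complex"
  assumes F: "F \<in> borel_measurable torus" and bound: "\<And>\<theta>. cmod (F \<theta>) \<le> B" and e: "e > 0"
  obtains Q where "trig_poly Q" "norm2 torus (\<lambda>\<theta>. F \<theta> - Q \<theta>) < e"
proof -
  interpret finite_measure "torus :: (real ^ 'd) measure" by (rule finite_measure_torus)
  obtain h where h: "\<And>n. continuous_on UNIV (h n)" "\<And>n \<theta>. \<theta> \<notin> torus_box \<Longrightarrow> h n \<theta> = 0"
    "\<And>n \<theta>. cmod (h n \<theta>) \<le> B" "AE \<theta> in torus. (\<lambda>n. h n \<theta>) \<longlonglongrightarrow> F \<theta>"
    using continuous_AE_approx[OF F bound] by blast
  have B: "B \<ge> 0" using bound[of undefined] norm_ge_zero order_trans by blast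
  have const: "(\<lambda>_ :: real ^ 'd. complex_of_real c) \<in> L2 torus" for c by (rule L2_bounded[of _ "\<bar>c\<bar>"]) auto
  have hm: "h n \<in> borel_measurable torus" for n
    by (intro borel_measurable_torusI borel_measurable_continuous_onI h)
  have "(\<lambda>n. norm2 torus (\<lambda>\<theta>. F \<theta> - h n \<theta>)) \<longlonglongrightarrow> 0"
  proof (rule norm2_dominated_convergence[OF const[of "2 * B"] F hm _ h(4)])
    show "AE \<theta> in torus. cmod (F \<theta> - h n \<theta>) \<le> cmod (complex_of_real (2 * B))" for n
    proof (rule AE_I2)
      show "cmod (F \<theta> - h n \<theta>) \<le> cmod (complex_of_real (2 * B))" for \<theta>
        using norm_triangle_ineq4[of "F \<theta>" "h n \<theta>"] bound[of \<theta>] h(3)[of n \<theta>] B by simp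
    qed
  qed
  from order_tendstoD(2)[OF this, of "e / 2"] e obtain n where n: "norm2 torus (\<lambda>\<theta>. F \<theta> - h n \<theta>) < e / 2"
    by (auto simp: eventually_sequentially)
  define c where "c = norm2 (torus :: (real ^ 'd) measure) (\<lambda>_. 1)"
  define d where "d = e / 2 / (c + 1)"
  have c: "c \<ge> 0" by (simp add: c_def norm2_nonneg)
  have d: "d > 0" "d * c \<le> e / 2" using c e by (auto simp: d_def field_simps)
  obtain Q where Q: "trig_poly Q" "\<And>\<theta>. \<theta> \<in> torus_cube \<Longrightarrow> cmod (h n \<theta> - Q \<theta>) < d"
    using trig_poly_uniform_approx[OF continuous_on_subset[OF h(1) subset_UNIV] _ d(1), of n] h(2)
    by auto
  have L: "F \<in> L2 torus" "h n \<in> L2 torus" "Q \<in> L2 torus"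
    by (rule L2_bounded[OF F AE_I2[OF bound]] L2_bounded[OF hm AE_I2[OF h(3)]] trig_poly_L2[OF Q(1)])+
  have "norm2 torus (\<lambda>\<theta>. F \<theta> - Q \<theta>) \<le> norm2 torus (\<lambda>\<theta>. F \<theta> - h n \<theta>) + norm2 torus (\<lambda>\<theta>. h n \<theta> - Q \<theta>)"
    by (intro norm2_triangle_diff L)
  also have "norm2 torus (\<lambda>\<theta>. h n \<theta> - Q \<theta>) \<le> norm2 (torus :: (real ^ 'd) measure) (\<lambda>_. complex_of_real d)"
  proof (rule norm2_mono[OF const])
    show "(\<lambda>\<theta>. h n \<theta> - Q \<theta>) \<in> borel_measurable torus" using L by (intro L2_measurable L2_diff)
    show "AE \<theta> in torus. cmod (h n \<theta> - Q \<theta>) \<le> cmod (complex_of_real d)"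
      using Q(2) d(1) by (intro AE_I2) (auto simp: space_torus less_imp_le)
  qed
  also have "\<dots> = d * c"
    using norm2_cmult[of torus "complex_of_real d" "\<lambda>_. 1"] d(1) by (simp add: c_def)
  finally show ?thesis using that Q(1) n d(2) by force
qed

text \<open>
  It suffices to approximate \<open>F / w\<close> after cutting off where \<open>F\<close> is large or \<open>w\<close> is small.
\<close>

lemma trig_poly_dense_weighted:
  fixes F w :: "real ^ 'd \<Rightarrow> complex"
  assumes F: "F \<in> L2 torus" and w: "w \<in> borel_measurable torus" "\<And>\<theta>. cmod (w \<theta>) \<le> W"
    and w0: "AE \<theta> in torus. w \<theta> \<noteq> 0" and e: "e > 0"
  obtains Q where "trig_poly Q" "norm2 torus (\<lambda>\<theta>. F \<theta> - w \<theta> * Q \<theta>) < e"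
proof -
  interpret finite_measure "torus :: (real ^ 'd) measure" by (rule finite_measure_torus)
  have W: "W \<ge> 0" using w(2)[of undefined] norm_ge_zero order_trans by blast
  note [measurable] = w(1) L2_measurable[OF F]
  \<comment> \<open>The product \<open>w \<theta> * C n \<theta>\<close> is either
    \<open>F \<theta>\<close> or 0, so \<open>F\<close> dominates the error. The threshold with
    \<open>Suc n\<close> is positive even for n = 0, and it bounds \<open>C n\<close> by n (n +
    1).\<close>
  define C where "C n \<theta> = (if cmod (F \<theta>) \<le> real n \<and> cmod (w \<theta>) \<ge> 1 / Suc n then F \<theta> / w \<theta> else 0)"
    for n :: nat and \<theta>
  have C: "C n \<in> borel_measurable torus" for n unfolding C_def by measurable
  have Cb: "cmod (C n \<theta>) \<le> real n * Suc n" for n \<theta>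
  proof (cases "cmod (F \<theta>) \<le> real n \<and> cmod (w \<theta>) \<ge> 1 / Suc n")
    case True
    then have "cmod (w \<theta>) > 0" by (rule less_le_trans[rotated, OF conjunct2]) simp
    have "cmod (C n \<theta>) = cmod (F \<theta>) / cmod (w \<theta>)" using True by (simp add: C_def norm_divide)
    also have "\<dots> \<le> real n / (1 / Suc n)" using True by (intro frac_le) auto
    finally show ?thesis by simp
  qed (auto simp: C_def)
  have "(\<lambda>n. norm2 torus (\<lambda>\<theta>. F \<theta> - w \<theta> * C n \<theta>)) \<longlonglongrightarrow> 0"
  proof (rule norm2_dominated_convergence[OF F])
    show "AE \<theta> in torus. cmod (F \<theta> - w \<theta> * C n \<theta>) \<le> cmod (F \<theta>)" for n
      using w0 by eventually_elim (simp add: C_def)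
    show "AE \<theta> in torus. (\<lambda>n. w \<theta> * C n \<theta>) \<longlonglongrightarrow> F \<theta>"
      using w0
    proof eventually_elim
      case (elim \<theta>)
      have "\<forall>\<^sub>F n in sequentially. max (cmod (F \<theta>)) (1 / cmod (w \<theta>)) \<le> real n"
        using filterlim_real_sequentially unfolding filterlim_at_top by blast
      then have "\<forall>\<^sub>F n in sequentially. w \<theta> * C n \<theta> = F \<theta>"
      proof eventually_elim
        case (elim n)
        then have "1 / cmod (w \<theta>) \<le> Suc n" by simp
        then have "1 / Suc n \<le> cmod (w \<theta>)" using \<open>w \<theta> \<noteq> 0\<close> by (simp add: field_simps)
        then show ?case using elim \<open>w \<theta> \<noteq> 0\<close> by (simp add: C_def)
      qed
      then show ?case by (rule tendsto_eventually)
    qed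
  qed (use C in measurable)
  from order_tendstoD(2)[OF this, of "e / 2"] e
  obtain n where n: "norm2 torus (\<lambda>\<theta>. F \<theta> - w \<theta> * C n \<theta>) < e / 2"
    by (auto simp: eventually_sequentially)
  \<comment> \<open>Multiplication by \<open>w\<close> enlarges the error at most by the factor
    \<open>W\<close>; the summand 1 covers W = 0.\<close>
  have "e / 2 / (W + 1) > 0" using e W by simp
  then obtain Q where Q: "trig_poly Q" "norm2 torus (\<lambda>\<theta>. C n \<theta> - Q \<theta>) < e / 2 / (W + 1)"
    using trig_poly_dense_bounded[OF C Cb] by blast
  have CQ: "(\<lambda>\<theta>. C n \<theta> - Q \<theta>) \<in> L2 torus"
    by (rule L2_diff[OF L2_bounded[OF C AE_I2[OF Cb]] trig_poly_L2[OF Q(1)]])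
  note [measurable] = L2_measurable[OF CQ] L2_measurable[OF trig_poly_L2[OF Q(1)]] C
  have *: "AE \<theta> in torus. cmod (w \<theta> * (C n \<theta> - Q \<theta>)) \<le> cmod (complex_of_real W * (C n \<theta> - Q \<theta>))"
    using w(2) W by (auto simp: norm_mult intro!: mult_right_mono)
  have "norm2 torus (\<lambda>\<theta>. F \<theta> - w \<theta> * Q \<theta>)
      = norm2 torus (\<lambda>\<theta>. (F \<theta> - w \<theta> * C n \<theta>) + w \<theta> * (C n \<theta> - Q \<theta>))"
    by (simp add: algebra_simps)
  also have "\<dots> \<le> norm2 torus (\<lambda>\<theta>. F \<theta> - w \<theta> * C n \<theta>) + norm2 torus (\<lambda>\<theta>. w \<theta> * (C n \<theta> - Q \<theta>))"
  proof (rule norm2_triangle)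
    show "(\<lambda>\<theta>. w \<theta> * (C n \<theta> - Q \<theta>)) \<in> L2 torus"
      by (rule L2_dominated[OF L2_cmult[OF CQ] _ *]) measurable
    show "(\<lambda>\<theta>. F \<theta> - w \<theta> * C n \<theta>) \<in> L2 torus"
      by (rule L2_dominated[OF F]) (use w0 in \<open>auto simp: C_def elim!: eventually_mono\<close>)
  qed
  also have "norm2 torus (\<lambda>\<theta>. w \<theta> * (C n \<theta> - Q \<theta>)) \<le> norm2 torus (\<lambda>\<theta>. complex_of_real W * (C n \<theta> - Q \<theta>))"
    by (rule norm2_mono[OF L2_cmult[OF CQ] _ *]) measurable
  also have "\<dots> = W * norm2 torus (\<lambda>\<theta>. C n \<theta> - Q \<theta>)" using W by (simp add: norm2_cmult)
  also have "\<dots> \<le> W * (e / 2 / (W + 1))" using W Q(2) by (intro mult_left_mono) auto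
  also have "\<dots> \<le> e / 2" using W e by (simp add: field_simps)
  finally show ?thesis using that Q(1) n by force
qed

text \<open>Completeness of the characters. Once \<open>A\<close> contains the frequencies of a
  trigonometric polynomial \<open>Q\<close> close to \<open>G\<close>, best approximation puts the
  partial Fourier sum at least as close to \<open>G\<close>.\<close>

lemma has_fourier_fourier_coeff:
  assumes G: "G \<in> L2 torus"
  shows "has_fourier (fourier_coeff G) G"
  unfolding has_fourier_iff
proof (intro conjI G tendstoI)
  fix e :: real assume "e > 0"
  then obtain Q where Q: "trig_poly Q" "norm2 torus (\<lambda>\<theta>. G \<theta> - Q \<theta>) < e"
    using trig_poly_dense_weighted[OF G, of "\<lambda>_. 1" 1 e] by auto
  from trig_poly_fourier_sum[OF Q(1)] obtain q where
    q: "q \<in> ell2_c" "\<And>A. finite A \<Longrightarrow> {n. q n \<noteq> 0} \<subseteq> A \<Longrightarrow> Q = fourier_sum q A" by blast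
  have "dist (norm2 torus (\<lambda>\<theta>. G \<theta> - fourier_sum (fourier_coeff G) A \<theta>)) 0 < e"
    if A: "finite A" "{n. q n \<noteq> 0} \<subseteq> A" for A
  proof -
    have "(norm2 torus (\<lambda>\<theta>. G \<theta> - fourier_sum (fourier_coeff G) A \<theta>))\<^sup>2 \<le> (norm2 torus (\<lambda>\<theta>. G \<theta> - Q \<theta>))\<^sup>2"
      unfolding q(2)[OF A] by (subst (2) norm2_diff_fourier_sum[OF G A(1)]) simp
    then have "norm2 torus (\<lambda>\<theta>. G \<theta> - fourier_sum (fourier_coeff G) A \<theta>) \<le> norm2 torus (\<lambda>\<theta>. G \<theta> - Q \<theta>)"
      by (rule power2_le_imp_le) (rule norm2_nonneg)
    then show ?thesis using Q(2) by (simp add: norm2_nonneg)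
  qed
  then show "\<forall>\<^sub>F A in finite_subsets_at_top UNIV.
      dist (norm2 torus (\<lambda>\<theta>. G \<theta> - fourier_sum (fourier_coeff G) A \<theta>)) 0 < e"
    using q(1) unfolding eventually_finite_subsets_at_top ell2_c_def
    by (intro exI[of _ "{n. q n \<noteq> 0}"]) auto
qed

lemma trig_poly_has_fourier:
  assumes "trig_poly P"
  obtains f where "f \<in> ell2_c" "has_fourier f P"
proof -
  obtain f where f: "f \<in> ell2_c" "\<And>A. finite A \<Longrightarrow> {n. f n \<noteq> 0} \<subseteq> A \<Longrightarrow> P = fourier_sum f A"
    using trig_poly_fourier_sum[OF assms] by blast
  have fin: "finite {n. f n \<noteq> 0}" using f(1) by (simp add: ell2_c_def)
  have "has_fourier f P" unfolding f(2)[OF fin order_refl] by (rule has_fourier_finite[OF fin]) simp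
  with that f(1) show ?thesis by blast
qed


section \<open>Fourier multipliers\<close>

lemma fourier_multiplierE:
  assumes "(f, g) \<in> fourier_multiplier m"
  obtains F G where "f \<in> ell2" "g \<in> ell2" "has_fourier f F" "has_fourier g G"
    "AE \<theta> in torus. G \<theta> = complex_of_real (m \<theta>) * F \<theta>"
  using assms unfolding fourier_multiplier_def by blast

lemma fourier_multiplierI:
  assumes "f \<in> ell2" "g \<in> ell2" "has_fourier f F" "has_fourier g G"
    "AE \<theta> in torus. G \<theta> = complex_of_real (m \<theta>) * F \<theta>"
  shows "(f, g) \<in> fourier_multiplier m"
  using assms unfolding fourier_multiplier_def by blast

lemma has_fourier_zero: "has_fourier (\<lambda>_. 0) (\<lambda>_. 0)"
  using has_fourier_finite[of "{}" "\<lambda>_. 0"] by (simp add: fourier_sum_def[abs_def])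

text \<open>The difference of two transforms of \<open>f\<close> is a transform of 0, so its norm is
  0 by the isometry. Since \<open>fourier_multiplier\<close> quantifies over representatives, this
  and injectivity are what makes its graph single-valued.\<close>

lemma has_fourier_unique_AE:
  assumes "has_fourier f F" "has_fourier f G"
  shows "AE \<theta> in torus. F \<theta> = G \<theta>"
proof -
  have *: "has_fourier (\<lambda>_. 0) (\<lambda>\<theta>. F \<theta> - G \<theta>)"
    using has_fourier_diff[OF assms] by simp
  then have "(\<lambda>\<theta>. F \<theta> - G \<theta>) \<in> L2 torus" by (simp add: has_fourier_iff)
  moreover have "norm2 torus (\<lambda>\<theta>. F \<theta> - G \<theta>) = 0"
    using ell2_norm_has_fourier[OF * ell2_zero] by (simp add: ell2_norm_zero)
  ultimately show ?thesis by (simp add: norm2_eq_0_iff)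
qed

lemma has_fourier_inj_AE:
  assumes "has_fourier f F" "has_fourier g G" "f \<in> ell2" "g \<in> ell2" "AE \<theta> in torus. F \<theta> = G \<theta>"
  shows "f = g"
proof -
  have *: "has_fourier (\<lambda>n. f n - g n) (\<lambda>\<theta>. F \<theta> - G \<theta>)"
    using assms by (intro has_fourier_diff)
  have "norm2 torus (\<lambda>\<theta>. F \<theta> - G \<theta>) = 0"
    using assms(5) * by (subst norm2_eq_0_iff) (auto simp: has_fourier_iff)
  then have "ell2_norm (\<lambda>n. f n - g n) = 0"
    using ell2_norm_has_fourier[OF * ell2_diff[OF assms(3,4)]] by simp
  then show ?thesis
    using ell2_norm_eq_0_iff[OF ell2_diff[OF assms(3,4)]] by (auto simp: fun_eq_iff)
qed

lemma linear_operator_fourier_multiplier: "linear_operator (fourier_multiplier m)"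
  unfolding linear_operator_def
proof (intro conjI)
  show "fourier_multiplier m \<subseteq> ell2 \<times> ell2" by (auto simp: fourier_multiplier_def)
  show "single_valued (fourier_multiplier m)"
  proof (rule single_valuedI)
    fix f g g' assume *: "(f, g) \<in> fourier_multiplier m" "(f, g') \<in> fourier_multiplier m"
    from *(1) obtain F G where F: "has_fourier f F" "has_fourier g G" "g \<in> ell2"
        "AE \<theta> in torus. G \<theta> = complex_of_real (m \<theta>) * F \<theta>"
      by (rule fourier_multiplierE)
    from *(2) obtain F' G' where F': "has_fourier f F'" "has_fourier g' G'" "g' \<in> ell2"
        "AE \<theta> in torus. G' \<theta> = complex_of_real (m \<theta>) * F' \<theta>"
      by (rule fourier_multiplierE)
    have "AE \<theta> in torus. G \<theta> = G' \<theta>"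
      using has_fourier_unique_AE[OF F(1) F'(1)] F(4) F'(4) by eventually_elim simp
    then show "g = g'" by (rule has_fourier_inj_AE[OF F(2) F'(2) F(3) F'(3)])
  qed
  show "((\<lambda>_. 0), (\<lambda>_. 0)) \<in> fourier_multiplier m"
    by (rule fourier_multiplierI[OF ell2_zero ell2_zero has_fourier_zero has_fourier_zero]) simp
  have "((\<lambda>x. f x + f' x), (\<lambda>x. g x + g' x)) \<in> fourier_multiplier m"
    if fg: "(f, g) \<in> fourier_multiplier m" "(f', g') \<in> fourier_multiplier m" for f g f' g'
  proof -
    from fg(1) obtain F G where F: "f \<in> ell2" "g \<in> ell2" "has_fourier f F" "has_fourier g G"
        "AE \<theta> in torus. G \<theta> = complex_of_real (m \<theta>) * F \<theta>"
      by (rule fourier_multiplierE)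
    from fg(2) obtain F' G' where F': "f' \<in> ell2" "g' \<in> ell2" "has_fourier f' F'" "has_fourier g' G'"
        "AE \<theta> in torus. G' \<theta> = complex_of_real (m \<theta>) * F' \<theta>"
      by (rule fourier_multiplierE)
    have "AE \<theta> in torus. G \<theta> + G' \<theta> = complex_of_real (m \<theta>) * (F \<theta> + F' \<theta>)"
      using F(5) F'(5) by eventually_elim (simp add: distrib_left)
    then show ?thesis
      using F F' by (intro fourier_multiplierI[OF _ _ has_fourier_add has_fourier_add] ell2_add)
  qed
  then show "\<forall>(u, v)\<in>fourier_multiplier m. \<forall>(u', v')\<in>fourier_multiplier m.
      ((\<lambda>x. u x + u' x), (\<lambda>x. v x + v' x)) \<in> fourier_multiplier m" by auto
  have "((\<lambda>x. c * f x), (\<lambda>x. c * g x)) \<in> fourier_multiplier m"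
    if fg: "(f, g) \<in> fourier_multiplier m" for c f g
  proof -
    from fg obtain F G where F: "f \<in> ell2" "g \<in> ell2" "has_fourier f F" "has_fourier g G"
        "AE \<theta> in torus. G \<theta> = complex_of_real (m \<theta>) * F \<theta>"
      by (rule fourier_multiplierE)
    have "AE \<theta> in torus. c * G \<theta> = complex_of_real (m \<theta>) * (c * F \<theta>)"
      using F(5) by eventually_elim simp
    then show ?thesis
      using F by (intro fourier_multiplierI[OF _ _ has_fourier_cmult has_fourier_cmult] ell2_cmult)
  qed
  then show "\<forall>c. \<forall>(u, v)\<in>fourier_multiplier m. ((\<lambda>x. c * u x), (\<lambda>x. c * v x)) \<in> fourier_multiplier m"
    by auto
qed

text \<open>By Parseval both sides are the integral of \<open>m\<close> times F times the conjugate
  of F'; a real \<open>m\<close> passes through the conjugation.\<close>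

lemma fourier_multiplier_symmetric:
  assumes "(f, g) \<in> fourier_multiplier m" "(f', g') \<in> fourier_multiplier m"
  shows "ell2_inner g f' = ell2_inner f g'"
proof -
  from assms(1) obtain F G where F: "has_fourier f F" "has_fourier g G"
      "AE \<theta> in torus. G \<theta> = complex_of_real (m \<theta>) * F \<theta>"
    by (rule fourier_multiplierE)
  from assms(2) obtain F' G' where F': "has_fourier f' F'" "has_fourier g' G'"
      "AE \<theta> in torus. G' \<theta> = complex_of_real (m \<theta>) * F' \<theta>"
    by (rule fourier_multiplierE)
  have L: "F \<in> L2 torus" "G \<in> L2 torus" "F' \<in> L2 torus" "G' \<in> L2 torus"
    using F F' by (auto simp: has_fourier_iff)
  have "inner2 torus G F' = inner2 torus F G'"
    unfolding inner2_def
  proof (rule integral_cong_AE)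
    show "AE \<theta> in torus. G \<theta> * cnj (F' \<theta>) = F \<theta> * cnj (G' \<theta>)"
      using F(3) F'(3) by eventually_elim simp
  qed (use L in \<open>auto intro!: borel_measurable_integrable integrable_inner2\<close>)
  then show ?thesis
    using F F' by (simp add: ell2_inner_has_fourier)
qed

lemma linear_operator_op_restrict_ell2_c:
  assumes "linear_operator T"
  shows "linear_operator (op_restrict T ell2_c)"
proof -
  have add: "(\<lambda>x. u x + v x) \<in> ell2_c" if "u \<in> ell2_c" "v \<in> ell2_c" for u v :: "'a \<Rightarrow> complex"
  proof -
    have "{x. u x + v x \<noteq> 0} \<subseteq> {x. u x \<noteq> 0} \<union> {x. v x \<noteq> 0}" by auto
    then show ?thesis using that finite_subset unfolding ell2_c_def by blast
  qed
  have cmult: "(\<lambda>x. c * u x) \<in> ell2_c" if "u \<in> ell2_c" for u :: "'a \<Rightarrow> complex" and c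
    using that by (auto simp: ell2_c_def)
  have zero: "(\<lambda>_. 0) \<in> ell2_c" by (simp add: ell2_c_def)
  have "single_valued (op_restrict T ell2_c)"
    using assms by (auto simp: linear_operator_def op_restrict_def single_valued_def)
  moreover have "op_restrict T ell2_c \<subseteq> ell2 \<times> ell2" "((\<lambda>_. 0), (\<lambda>_. 0)) \<in> op_restrict T ell2_c"
    using assms zero by (auto simp: linear_operator_def op_restrict_def)
  moreover have "\<forall>(u, v)\<in>op_restrict T ell2_c. \<forall>(u', v')\<in>op_restrict T ell2_c.
      ((\<lambda>x. u x + u' x), (\<lambda>x. v x + v' x)) \<in> op_restrict T ell2_c"
    using assms by (auto simp: linear_operator_def op_restrict_def intro: add)
  moreover have "\<forall>c. \<forall>(u, v)\<in>op_restrict T ell2_c.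
      ((\<lambda>x. c * u x), (\<lambda>x. c * v x)) \<in> op_restrict T ell2_c"
    using assms by (auto simp: linear_operator_def op_restrict_def intro: cmult)
  ultimately show ?thesis unfolding linear_operator_def by (intro conjI)
qed

lemma trig_poly_bounded:
  assumes "trig_poly P"
  obtains B where "\<And>\<theta>. cmod (P \<theta>) \<le> B"
proof -
  have "\<exists>B. \<forall>\<theta>. cmod (P \<theta>) \<le> B"
    using assms
  proof induction
    case (monom c n)
    then show ?case by (auto simp: norm_mult character_def)
  next
    case (add P Q)
    then obtain B C where "\<And>\<theta>. cmod (P \<theta>) \<le> B" "\<And>\<theta>. cmod (Q \<theta>) \<le> C" by blast
    then have "cmod (P \<theta> + Q \<theta>) \<le> B + C" for \<theta>
      by (intro order_trans[OF norm_triangle_ineq] add_mono)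
    then show ?case by blast
  qed
  with that show ?thesis by blast
qed

text \<open>Separates the operator theory from the particular symbol. The bound on m \<psi> serves
  twice: it puts m \<psi> Q into \<open>L2\<close> and bounds the weight \<open>w\<close>.\<close>

theorem essentially_self_adjoint_fourier_multiplier:
  fixes m :: "real ^ 'd \<Rightarrow> real"
  assumes m: "m \<in> borel_measurable borel" and \<psi>: "trig_poly \<psi>"
    and \<psi>0: "AE \<theta> in torus. \<psi> \<theta> \<noteq> 0" and bound: "\<And>\<theta>. cmod (complex_of_real (m \<theta>) * \<psi> \<theta>) \<le> B"
  shows "essentially_self_adjoint_on (fourier_multiplier m) ell2_c"
proof -
  let ?T = "op_restrict (fourier_multiplier m) ell2_c"
  have mt [measurable]: "m \<in> borel_measurable torus" by (rule borel_measurable_torusI[OF m])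
  have \<psi>t [measurable]: "\<psi> \<in> borel_measurable torus" using trig_poly_L2[OF \<psi>] by (rule L2_measurable)
  obtain C where C: "\<And>\<theta>. cmod (\<psi> \<theta>) \<le> C" using trig_poly_bounded[OF \<psi>] by blast
  \<comment> \<open>General \<open>a\<close> and \<open>b\<close> let one statement give the dense
    ranges of T \<plusminus> i and, with a = 0 and b = 1, the dense domain.\<close>
  have dense: "\<exists>(u, v)\<in>?T. ell2_norm (\<lambda>x. h x - (a * v x + b * u x)) < e"
    if h: "h \<in> ell2" and e: "e > 0" and ab: "\<And>t. a * complex_of_real t + b \<noteq> 0" for h e a b
  proof -
    obtain h0 where h0: "h0 \<in> ell2_c" "ell2_norm (\<lambda>x. h x - h0 x) < e / 2"
      using ell2_c_dense[OF h, of "e / 2"] e by auto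
    have fin: "finite {x. h0 x \<noteq> 0}" using h0(1) by (simp add: ell2_c_def)
    define H where "H = fourier_sum h0 {x. h0 x \<noteq> 0}"
    have H: "has_fourier h0 H" unfolding H_def by (rule has_fourier_finite[OF fin]) simp
    have HL: "H \<in> L2 torus" using H by (simp add: has_fourier_iff)
    define w where "w \<theta> = (a * complex_of_real (m \<theta>) + b) * \<psi> \<theta>" for \<theta>
    have w: "w \<in> borel_measurable torus" unfolding w_def by measurable
    have wb: "cmod (w \<theta>) \<le> cmod a * B + cmod b * C" for \<theta>
    proof -
      have "cmod (w \<theta>) \<le> cmod (a * (complex_of_real (m \<theta>) * \<psi> \<theta>)) + cmod (b * \<psi> \<theta>)"
        unfolding w_def using norm_triangle_ineq by (simp only: distrib_right mult.assoc)
      also have "\<dots> \<le> cmod a * B + cmod b * C"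
        unfolding norm_mult[of a] norm_mult[of b] by (intro add_mono mult_left_mono bound C) auto
      finally show ?thesis .
    qed
    have w0: "AE \<theta> in torus. w \<theta> \<noteq> 0"
      using \<psi>0 by eventually_elim (simp add: w_def ab)
    obtain Q where Q: "trig_poly Q" "norm2 torus (\<lambda>\<theta>. H \<theta> - w \<theta> * Q \<theta>) < e / 2"
      using trig_poly_dense_weighted[OF HL w wb w0, of "e / 2"] e by auto
    obtain u where u: "u \<in> ell2_c" "has_fourier u (\<lambda>\<theta>. \<psi> \<theta> * Q \<theta>)"
      using trig_poly_has_fourier[OF trig_poly_mult[OF \<psi> Q(1)]] .
    \<comment> \<open>The transform of T u. As a bounded multiple of \<open>Q\<close> it is
      square-integrable, and completeness of the characters turns it into the sequence
      \<open>v\<close>.\<close>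
    define V where "V \<theta> = complex_of_real (m \<theta>) * \<psi> \<theta> * Q \<theta>" for \<theta>
    have [measurable]: "Q \<in> borel_measurable torus" using trig_poly_L2[OF Q(1)] by (rule L2_measurable)
    have V: "V \<in> L2 torus"
    proof (rule L2_dominated[OF L2_cmult[OF trig_poly_L2[OF Q(1)], of "complex_of_real B"]])
      show "V \<in> borel_measurable torus" unfolding V_def by measurable
      have "cmod (complex_of_real (m \<theta>) * \<psi> \<theta>) \<le> \<bar>B\<bar>" for \<theta> using bound[of \<theta>] by linarith
      then show "AE \<theta> in torus. cmod (V \<theta>) \<le> cmod (complex_of_real B * Q \<theta>)"
        unfolding V_def norm_mult[of _ "Q _"] by (intro AE_I2 mult_right_mono) simp_all
    qed
    define v where "v = fourier_coeff V"
    have v: "v \<in> ell2" "has_fourier v V"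
      unfolding v_def using V by (rule fourier_coeff_ell2 has_fourier_fourier_coeff)+
    have u2: "u \<in> ell2" using u(1) by (rule ell2_c_subset)
    have "(u, v) \<in> fourier_multiplier m"
      by (rule fourier_multiplierI[OF u2 v(1) u(2) v(2)]) (simp add: V_def mult.assoc)
    then have uv: "(u, v) \<in> ?T" using u(1) by (simp add: op_restrict_def)
    define k where "k x = a * v x + b * u x" for x
    have k: "k \<in> ell2" unfolding k_def by (intro ell2_add ell2_cmult v u2)
    have h02: "h0 \<in> ell2" using h0(1) by (rule ell2_c_subset)
    have "has_fourier k (\<lambda>\<theta>. a * V \<theta> + b * (\<psi> \<theta> * Q \<theta>))"
      unfolding k_def by (intro has_fourier_add has_fourier_cmult v u)
    also have "(\<lambda>\<theta>. a * V \<theta> + b * (\<psi> \<theta> * Q \<theta>)) = (\<lambda>\<theta>. w \<theta> * Q \<theta>)"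
      by (simp add: V_def w_def fun_eq_iff algebra_simps)
    finally have "ell2_norm (\<lambda>x. h0 x - k x) < e / 2"
      using ell2_norm_has_fourier[OF has_fourier_diff[OF H] ell2_diff[OF h02 k]] Q(2) by simp
    then have "ell2_norm (\<lambda>x. h x - k x) < e"
      using ell2_norm_triangle_diff[OF h h02 k] h0(2) by linarith
    then show ?thesis using uv unfolding k_def by blast
  qed
  have lin: "linear_operator ?T"
    by (intro linear_operator_op_restrict_ell2_c linear_operator_fourier_multiplier)
  have "densely_defined ?T"
    unfolding densely_defined_def
  proof (intro ballI allI impI)
    fix f :: "int ^ 'd \<Rightarrow> complex" and e :: real assume "f \<in> ell2" "e > 0"
    from dense[OF this, of 0 1] obtain u v where "(u, v) \<in> ?T" "ell2_norm (\<lambda>x. f x - u x) < e" by auto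
    then show "\<exists>u\<in>Domain ?T. ell2_norm (\<lambda>x. f x - u x) < e" by blast
  qed
  with lin have sym: "symmetric_operator ?T"
    using fourier_multiplier_symmetric by (auto simp: symmetric_operator_def op_restrict_def)
  have nz: "1 * complex_of_real t + c \<noteq> 0" if "c = \<i> \<or> c = - \<i>" for c t
    using that by (auto simp: complex_eq_iff)
  have "essentially_self_adjoint ?T"
    using dense[OF _ _ nz] by (intro essentially_self_adjoint_if_dense_range[OF sym]) simp
  then show ?thesis by (simp add: essentially_self_adjoint_on_def)
qed

theorem proposition2p9:
  fixes r :: "real ^ 'd"
  shows "essentially_self_adjoint_on (frac_laplacian r) (ell2_c :: (int ^ 'd \<Rightarrow> complex) set)"
proof -
  \<comment> \<open>The sum of the |r_j| bounds each of them, so \<open>r $ j + real k\<close> is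
    nonnegative for every j at once.\<close>
  define k where "k = nat \<lceil>\<Sum>j\<in>UNIV. \<bar>r $ j\<bar>\<rceil>"
  have k: "0 \<le> r $ j + real k" for j
  proof -
    have "\<bar>r $ j\<bar> \<le> (\<Sum>j\<in>UNIV. \<bar>r $ j\<bar>)" by (rule member_le_sum) auto
    also have "\<dots> \<le> real k" unfolding k_def by (rule real_nat_ceiling_ge)
    finally show ?thesis by linarith
  qed
  define x where "x \<theta> j = 2 - 2 * cos (\<theta> $ j)" for \<theta> :: "real ^ 'd" and j
  have x: "0 \<le> x \<theta> j" "x \<theta> j \<le> 4" for \<theta> j
    using cos_le_one[of "\<theta> $ j"] cos_ge_minus_one[of "\<theta> $ j"] unfolding x_def by linarith+
  define m where "m \<theta> = (\<Sum>j\<in>UNIV. x \<theta> j powr (r $ j))" for \<theta>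
  define \<psi> where "\<psi> \<theta> = (\<Prod>j\<in>UNIV. complex_of_real (x \<theta> j) ^ k)" for \<theta>
  have "trig_poly (\<lambda>\<theta>. complex_of_real 2 - complex_of_real 2 * complex_of_real (cos (\<theta> $ j)))" for j :: 'd
    by (intro trig_poly_diff trig_poly_const trig_poly_mult trig_poly_cos)
  then have "trig_poly \<psi>"
    unfolding \<psi>_def x_def by (intro trig_poly_prod trig_poly_power) simp
  moreover have "AE \<theta> in torus. \<psi> \<theta> \<noteq> 0"
  proof -
    \<comment> \<open>In the open box \<open>x \<theta> j\<close> vanishes only where \<theta>_j =
      0, and these hyperplanes are null sets.\<close>
    have "AE \<theta> in torus. \<theta> \<notin> {\<theta>. \<theta> $ j = (0::real)}" for j :: 'd
      by (intro AE_torus_not_in_negligible negligible_standard_hyperplane_cart)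
    then have "AE \<theta> in torus. \<forall>j :: 'd. \<theta> $ j \<noteq> (0::real)" by (simp add: AE_all_countable)
    with AE_torus_box show ?thesis
    proof eventually_elim
      case (elim \<theta>)
      have "x \<theta> j \<noteq> 0" for j
      proof
        assume "x \<theta> j = 0"
        then have "cos (\<theta> $ j) = 1" by (simp add: x_def)
        then obtain n :: int where n: "\<theta> $ j = of_int n * 2 * pi" by (auto simp: cos_one_2pi_int)
        have "\<bar>\<theta> $ j\<bar> < pi" using elim by (auto simp: mem_box_cart abs_less_iff dest: spec[of _ j])
        then have "\<bar>of_int n\<bar> * 2 < (1::real)" unfolding n by (simp add: abs_mult)
        then have "n = 0" by linarith
        then show False using n elim by simp
      qed
      then show ?case by (simp add: \<psi>_def)
    qed
  qed
  \<comment> \<open>In the j-th summand of m \<psi> the factor of index j becomes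
    \<open>x \<theta> j powr (r $ j + real k)\<close>, with nonnegative exponent; each other factor
    is at most \<open>4 ^ k\<close>, since 0 \<le> x \<le> 4.\<close>
  moreover have "cmod (complex_of_real (m \<theta>) * \<psi> \<theta>) \<le>
      (\<Sum>j\<in>UNIV. 4 powr (r $ j + real k) * (\<Prod>i\<in>UNIV - {j}. 4 ^ k))" for \<theta>
  proof -
    have "complex_of_real (m \<theta>) * \<psi> \<theta> =
        complex_of_real (\<Sum>j\<in>UNIV. x \<theta> j powr (r $ j) * (\<Prod>i\<in>UNIV. x \<theta> i ^ k))"
      by (simp add: \<psi>_def m_def sum_distrib_right)
    moreover have "0 \<le> (\<Sum>j\<in>UNIV. x \<theta> j powr (r $ j) * (\<Prod>i\<in>UNIV. x \<theta> i ^ k))"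
      by (intro sum_nonneg mult_nonneg_nonneg prod_nonneg zero_le_power x powr_ge_zero)
    ultimately have "cmod (complex_of_real (m \<theta>) * \<psi> \<theta>) =
        (\<Sum>j\<in>UNIV. x \<theta> j powr (r $ j) * (\<Prod>i\<in>UNIV. x \<theta> i ^ k))"
      by (simp only: norm_of_real abs_of_nonneg)
    also have "\<dots> \<le> (\<Sum>j\<in>UNIV. 4 powr (r $ j + real k) * (\<Prod>i\<in>UNIV - {j}. 4 ^ k))"
    proof (rule sum_mono)
      fix j
      have "x \<theta> j powr (r $ j) * x \<theta> j ^ k \<le> 4 powr (r $ j + real k)"
      \<comment> \<open>At zero the convention \<open>0 powr a = 0\<close> makes the left side 0
        even for negative exponents; merging the powers by \<open>powr_realpow\<close> requires a
        positive base.\<close>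
      proof (cases "x \<theta> j = 0")
        case False
        then have "x \<theta> j powr (r $ j) * x \<theta> j ^ k = x \<theta> j powr (r $ j + real k)"
          using x[of \<theta> j] by (simp add: powr_add powr_realpow)
        also have "\<dots> \<le> 4 powr (r $ j + real k)" by (intro powr_mono2 k x)
        finally show ?thesis .
      qed simp
      moreover have "(\<Prod>i\<in>UNIV - {j}. x \<theta> i ^ k) \<le> (\<Prod>i\<in>UNIV - {j}. 4 ^ k)"
        by (intro prod_mono conjI power_mono zero_le_power x)
      ultimately have "(x \<theta> j powr (r $ j) * x \<theta> j ^ k) * (\<Prod>i\<in>UNIV - {j}. x \<theta> i ^ k) \<le>
          4 powr (r $ j + real k) * (\<Prod>i\<in>UNIV - {j}. 4 ^ k)"
        by (intro mult_mono prod_nonneg) (auto simp: x)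
      then show "x \<theta> j powr (r $ j) * (\<Prod>i\<in>UNIV. x \<theta> i ^ k) \<le>
          4 powr (r $ j + real k) * (\<Prod>i\<in>UNIV - {j}. 4 ^ k)"
        by (subst prod.remove[of UNIV j]) (simp_all add: mult.assoc)
    qed
    finally show ?thesis .
  qed
  moreover have "m \<in> borel_measurable borel"
    unfolding m_def x_def by measurable
  ultimately have "essentially_self_adjoint_on (fourier_multiplier m) ell2_c"
    by (intro essentially_self_adjoint_fourier_multiplier)
  then show ?thesis by (simp add: frac_laplacian_def m_def[abs_def] x_def)
qed

end
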